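(* Let $Y, Z \subset \mathbb{R}$ be countable sets such that $Z \subset \mathbb{R} \setminus \operatorname{Span}_{\mathbb{Q}}(\{1\} \cup Y)$. Then there exists a function $\psi : \mathbb{N} \to \mathbb{R}_{\geq 0}$ such that \[ \mu(W(\psi, y)) = 0 \qquad \text{and} \qquad \mu(W(\psi, z)) = 1 \] for every $y \in Y$ and every $z \in Z$.
   Context: $\mathbb{N}$ denotes the positive integers. For $t \in \mathbb{R}$, $\|t\|$ denotes the distance from $t$ to the nearest integer. For $\psi : \mathbb{N} \to \mathbb{R}_{\geq 0}$ and $y \in \mathbb{R}$, \[ W(\psi, y) = \{x \in [0,1] : \|qx - y\| < \psi(q) \text{ for infinitely many } q \in \mathbb{N}\}. \] $\mu$ denotes Lebesgue measure. *)

theory Defs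
  imports "HOL-Analysis.Analysis"
begin

global_interpretation rat_real: vector_space "\<lambda>(r::rat) (x::real). of_rat r * x"
  defines span_Q = rat_real.span
  by standard (simp_all add: algebra_simps of_rat_add of_rat_mult)

definition dist_int :: "real \<Rightarrow> real"
  where "dist_int t = infdist t \<int>"

text \<open>The argument \<open>\<psi>\<close> is a function on all of \<^typ>\<open>nat\<close>, but only its values at positive
  integers matter.\<close>

definition W :: "(nat \<Rightarrow> real) \<Rightarrow> real \<Rightarrow> real set"
  where "W \<psi> y = {x \<in> {0..1}. infinite {q::nat. q > 0 \<and> dist_int (real q * x - y) < \<psi> q}}"

text \<open>\<^const>\<open>emeasure\<close> is \<open>0\<close> on non-measurable sets by convention; by the following lemma that
  convention never applies to the sets \<open>W \<psi> y\<close>.\<close>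

lemma W_borel: "W \<psi> y \<in> sets borel"
proof -
  have [measurable]: "(\<lambda>x. dist_int (real q * x - y)) \<in> borel_measurable borel" for q
    unfolding dist_int_def by (intro borel_measurable_continuous_onI continuous_intros)
  have "W \<psi> y = {x \<in> space borel. x \<in> {0..1} \<and>
      (\<exists>\<^sub>\<infinity>q. q > 0 \<and> dist_int (real q * x - y) < \<psi> q)}"
    by (auto simp: W_def frequently_cofinite)
  also have "\<dots> \<in> sets borel"
    unfolding INFM_nat by measurable
  finally show ?thesis .
qed

corollary W_lebesgue: "W \<psi> y \<in> sets lebesgue"
  using W_borel by (simp add: in_borel_measurable_borel sets_completionI_sets)

end

theory Submission
  imports Defs
begin

text \<open>
  Let \<open>1, b\<^sub>1, \<dots>, b\<^sub>r\<close> be a \<open>\<rat>\<close>-basis of the span of \<open>1\<close> and finitely many elements of \<open>Y\<close>, and let \<open>D\<close> be a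
  finite set of \<open>d\<close> for which all \<open>\<parallel>d b\<^sub>j\<parallel>\<close> are tiny. Let \<open>P\<close> be a common multiple of \<open>D\<close> and put
  \<open>\<psi>(P/d) = \<epsilon>/d\<close>. If \<open>\<parallel>(P/d) x - y\<parallel> < \<epsilon>/d\<close>, then multiplication by \<open>d R\<close>, where \<open>R\<close> is a denominator of
  \<open>y\<close> over the basis, shows that \<open>\<parallel>P R x\<parallel>\<close> is small, and this bad set does not depend on \<open>d\<close>. For \<open>z\<close>,
  in contrast, the sets for \<open>d\<close> and \<open>d'\<close> with \<open>g = gcd(d, d')\<close> meet in measure \<open>O(\<epsilon> g / (d d'))\<close>, and only if
  \<open>\<parallel>(d - d') z / g\<parallel> < 2 \<epsilon> / g\<close>. As \<open>1, b\<^sub>1, \<dots>, b\<^sub>r, z\<close> are independent, Kronecker's theorem makes the sets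
  independent on average up to a constant, so the second moment method bounds the measure of
  their union below by some \<open>\<kappa>\<close> that depends on \<open>r\<close> only. Dilating \<open>x \<mapsto> M x\<close> is mixing, so boundedly many dilates of this
  construction cover almost everything for \<open>z\<close>, while the bad sets stay small since \<open>\<epsilon>\<close> may be chosen
  after \<open>\<kappa>\<close>. Borel--Cantelli concludes.
\<close>

section \<open>Distance to the nearest integer and Kronecker's theorem\<close>

text \<open>The second moment must be quadratic in \<epsilon>, but the geometry of a pair of hits
  yields only one factor \<epsilon>; the closeness condition on z has to supply the other.
  Kronecker's theorem gives this saving with an error that is not explicit and depends on the gcd g.
  It therefore serves only for a fixed d against d' in a much larger range (X, 2 X], and blocks are
  chosen one after another, each far beyond the previous ones. Inside a block d and d' have the same
  size, g may reach 2 X, and an explicit count is needed: it comes from a good rational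
  approximation of z, which separates the multiples of z up to h, with X = h^2. It gives only O(1)
  per block, a cost linear in the number L of blocks against a main term quadratic in L. The Bohr
  tolerance disappears from the final constant because the square of the sum of 1/d and the sum over
  pairs both scale with the square of the density of the Bohr set; counting that set from above and
  from below loses only a power of 16.\<close>

lemma dist_int_le: "dist_int t \<le> \<bar>t - of_int k\<bar>"
  unfolding dist_int_def using infdist_le[of "of_int k" \<int> t] by (simp add: dist_real_def)

lemma dist_int_nonneg: "0 \<le> dist_int t"
  unfolding dist_int_def by (rule infdist_nonneg)

lemma dist_int_attained: "\<exists>k::int. dist_int t = \<bar>t - of_int k\<bar>"
proof -
  have "closed (\<int>::real set)" "(\<int>::real set) \<noteq> {}"
    using Ints_0 by auto
  then obtain w where "w \<in> \<int>" "infdist t \<int> = dist t w"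
    by (metis infdist_attains_inf)
  then show ?thesis
    by (auto simp: dist_int_def dist_real_def elim!: Ints_cases)
qed

lemma dist_int_less_iff: "dist_int t < \<delta> \<longleftrightarrow> (\<exists>k::int. \<bar>t - of_int k\<bar> < \<delta>)"
  using dist_int_attained[of t] dist_int_le[of t] by (metis le_less_trans)

lemma dist_int_add: "dist_int (s + t) \<le> dist_int s + dist_int t"
proof -
  obtain j k where "dist_int s = \<bar>s - of_int j\<bar>" "dist_int t = \<bar>t - of_int k\<bar>"
    using dist_int_attained by metis
  then show ?thesis
    using dist_int_le[of "s + t" "j + k"] by simp
qed

lemma dist_int_uminus: "dist_int (- t) = dist_int t"
proof -
  have "dist_int (- t) \<le> dist_int t" for t
  proof -
    obtain k where "dist_int t = \<bar>t - of_int k\<bar>"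
      using dist_int_attained by metis
    then show ?thesis
      using dist_int_le[of "- t" "- k"] by simp
  qed
  from this[of t] this[of "- t"] show ?thesis by simp
qed

lemma dist_int_diff: "dist_int (s - t) \<le> dist_int s + dist_int t"
  using dist_int_add[of s "- t"] by (simp add: dist_int_uminus)

lemma dist_int_add_int: "dist_int (t + of_int k) = dist_int t"
proof -
  have "dist_int (t + of_int k) \<le> dist_int t" for t k
  proof -
    obtain j where "dist_int t = \<bar>t - of_int j\<bar>"
      using dist_int_attained by metis
    then show ?thesis
      using dist_int_le[of "t + of_int k" "j + k"] by simp
  qed
  from this[of t k] this[of "t + of_int k" "- k"] show ?thesis by simp
qed

lemma dist_int_mult_le: "dist_int (of_int k * t) \<le> \<bar>of_int k\<bar> * dist_int t"
proof -
  obtain j where "dist_int t = \<bar>t - of_int j\<bar>"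
    using dist_int_attained by metis
  moreover have "\<bar>of_int k * t - of_int (k * j)\<bar> = \<bar>of_int k\<bar> * \<bar>t - of_int j\<bar>"
    by (simp add: algebra_simps flip: abs_mult)
  ultimately show ?thesis
    using dist_int_le[of "of_int k * t" "k * j"] by simp
qed

lemma dist_int_rational_ge:
  fixes a b :: int and q :: nat
  assumes "\<not> int q dvd a"
  shows "1 / real q \<le> dist_int (of_int a / real q)"
proof -
  obtain k where k: "dist_int (of_int a / real q) = \<bar>of_int a / real q - of_int k\<bar>"
    using dist_int_attained by metis
  have "a - k * int q \<noteq> 0"
    using assms by auto
  then have "1 \<le> \<bar>real_of_int (a - k * int q)\<bar>"
    by linarith
  moreover have "\<bar>of_int a / real q - of_int k\<bar> = \<bar>real_of_int (a - k * int q)\<bar> / real q"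
    if "q \<noteq> 0"
  proof -
    have "of_int a / real q - of_int k = real_of_int (a - k * int q) / real q"
      using that by (simp add: field_simps)
    then show ?thesis
      by (simp add: abs_divide)
  qed
  ultimately show ?thesis
    using k dist_int_nonneg by (cases "q = 0") (simp_all add: divide_right_mono)
qed

text \<open>Says that 1 and the \<open>\<theta> j\<close> are linearly independent over the
  rationals, phrased with integer relations as in Kronecker's theorem. An indexed family instead of
  a set allows coordinates to be rescaled separately.\<close>

definition free_mod_1 :: "'a set \<Rightarrow> ('a \<Rightarrow> real) \<Rightarrow> bool"
  where "free_mod_1 J \<theta> \<longleftrightarrow> finite J \<and>
    (\<forall>n :: 'a \<Rightarrow> int. (\<Sum>j\<in>J. of_int (n j) * \<theta> j) \<in> \<int> \<longrightarrow> (\<forall>j\<in>J. n j = 0))"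

lemma free_mod_1_finite: "free_mod_1 J \<theta> \<Longrightarrow> finite J"
  by (simp add: free_mod_1_def)

text \<open>Writing d = g e turns a condition on \<open>d * \<theta> j\<close> into one on e and the
  scaled number \<open>g * \<theta> j\<close>; Kronecker's theorem must stay available for these
  quotients.\<close>

lemma free_mod_1_scale:
  assumes "free_mod_1 J \<theta>" and "\<And>j. j \<in> J \<Longrightarrow> c j \<noteq> (0::int)"
  shows "free_mod_1 J (\<lambda>j. of_int (c j) * \<theta> j)"
  unfolding free_mod_1_def
proof (intro conjI allI impI)
  show "finite J"
    using assms(1) by (rule free_mod_1_finite)
next
  fix n :: "'a \<Rightarrow> int"
  assume "(\<Sum>j\<in>J. of_int (n j) * (of_int (c j) * \<theta> j)) \<in> \<int>"
  then have "(\<Sum>j\<in>J. of_int (n j * c j) * \<theta> j) \<in> \<int>"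
    by (simp add: mult.assoc)
  then have "\<forall>j\<in>J. n j * c j = 0"
    using assms(1) unfolding free_mod_1_def by (elim conjE allE[of _ "\<lambda>j. n j * c j"]) blast
  then show "\<forall>j\<in>J. n j = 0"
    using assms(2) by auto
qed

lemma free_mod_1_subset:
  assumes "free_mod_1 J \<theta>" and "I \<subseteq> J"
  shows "free_mod_1 I \<theta>"
  unfolding free_mod_1_def
proof (intro conjI allI impI)
  show "finite I"
    using assms free_mod_1_finite finite_subset by blast
next
  fix n :: "'a \<Rightarrow> int"
  define n' where "n' j = (if j \<in> I then n j else 0)" for j
  assume "(\<Sum>j\<in>I. of_int (n j) * \<theta> j) \<in> \<int>"
  moreover have "(\<Sum>j\<in>J. of_int (n' j) * \<theta> j) = (\<Sum>j\<in>I. of_int (n j) * \<theta> j)"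
    using assms free_mod_1_finite[OF assms(1)]
    by (intro sum.mono_neutral_cong_right) (auto simp: n'_def)
  ultimately have "\<forall>j\<in>J. n' j = 0"
    using assms(1) unfolding free_mod_1_def by metis
  then show "\<forall>j\<in>I. n j = 0"
    using assms(2) by (auto simp: n'_def split: if_splits)
qed

lemma Kronecker_free_mod_1:
  assumes "free_mod_1 J \<theta>" and "\<eta> > 0"
  shows "\<exists>s::int. \<forall>j\<in>J. dist_int (of_int s * \<theta> j - \<alpha> j) < \<eta>"
proof -
  interpret Modules.module "(\<lambda>r. (*) (real_of_int r))"
    by (simp add: Modules.module.intro distrib_left mult.commute)
  have fin: "finite J" and fr: "\<And>n. (\<Sum>j\<in>J. of_int (n j) * \<theta> j) \<in> \<int> \<Longrightarrow> \<forall>j\<in>J. n j = (0::int)"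
    using assms(1) by (auto simp: free_mod_1_def)
  obtain f where f: "bij_betw f {..<card J} J"
    using fin bij_betw_from_nat_into_finite by blast
  define N where "N = card J"
  \<comment> \<open>\<open>Kronecker_thm_2\<close> takes a family indexed by an initial segment of
    the naturals whose last entry is 1; that entry turns a combination with integral value into a
    vanishing one.\<close>
  define \<phi> where "\<phi> i = (if i < N then \<theta> (f i) else 1)" for i
  have zero: "\<forall>i\<le>N. u i = 0" if "(\<Sum>i\<le>N. of_int (u i) * \<phi> i) = 0" for u :: "nat \<Rightarrow> int"
  proof -
    define n where "n j = u (the_inv_into {..<N} f j)" for j
    have n: "n (f i) = u i" if "i < N" for i
      using that f by (simp add: n_def N_def bij_betw_def the_inv_into_f_f)
    have split: "(\<Sum>i\<le>N. of_int (u i) * \<phi> i) = (\<Sum>i<N. of_int (u i) * \<theta> (f i)) + of_int (u N)"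
      by (simp add: \<phi>_def flip: lessThan_Suc_atMost)
    have "(\<Sum>j\<in>J. of_int (n j) * \<theta> j) = (\<Sum>i<N. of_int (u i) * \<theta> (f i))"
      using sum.reindex_bij_betw[OF f, of "\<lambda>j. of_int (n j) * \<theta> j"] n by (simp add: N_def)
    also have "\<dots> = of_int (- u N)"
      using that split by simp
    finally have "\<forall>j\<in>J. n j = 0"
      using fr Ints_of_int by metis
    then have 1: "\<forall>i<N. u i = 0"
      using n f by (metis N_def bij_betwE lessThan_iff)
    with that split show ?thesis
      by (auto simp: le_less)
  qed
  have inj: "inj_on \<phi> {..N}"
  proof (rule inj_onI, rule ccontr)
    fix i i' assume *: "i \<in> {..N}" "i' \<in> {..N}" "\<phi> i = \<phi> i'" "i \<noteq> i'"
    define u :: "nat \<Rightarrow> int" where "u = (\<lambda>_. 0)(i := 1, i' := -1)"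
    have "(\<Sum>k\<le>N. of_int (u k) * \<phi> k) = (\<Sum>k\<in>{i,i'}. of_int (u k) * \<phi> k)"
      using * by (intro sum.mono_neutral_right) (auto simp: u_def)
    also have "\<dots> = 0"
      using * by (simp add: u_def)
    finally show False
      using zero[of u] * by (auto simp: u_def)
  qed
  have ind: "independent (\<phi> ` {..N})"
    unfolding independent_explicit_module
  proof (intro allI impI)
    fix t and u :: "real \<Rightarrow> int" and v
    assume t: "finite t" "t \<subseteq> \<phi> ` {..N}" "(\<Sum>v\<in>t. of_int (u v) * v) = 0" "v \<in> t"
    define u' where "u' i = (if \<phi> i \<in> t then u (\<phi> i) else 0)" for i
    have "(\<Sum>i\<le>N. of_int (u' i) * \<phi> i) = (\<Sum>x\<in>\<phi> ` {..N}. of_int (if x \<in> t then u x else 0) * x)"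
      by (subst sum.reindex[OF inj]) (auto simp: u'_def)
    also have "\<dots> = (\<Sum>v\<in>t. of_int (u v) * v)"
      using t by (intro sum.mono_neutral_cong_right) auto
    finally have "\<forall>i\<le>N. u' i = 0"
      using t zero by simp
    then show "u v = 0"
      using t by (force simp: u'_def)
  qed
  obtain k m where km: "\<And>i. i < N \<Longrightarrow> \<bar>of_int k * \<phi> i - of_int (m i) - \<alpha> (f i)\<bar> < \<eta>"
    using Kronecker_thm_2[OF ind inj _ assms(2), of "\<alpha> \<circ> f"] by (auto simp: \<phi>_def)
  show ?thesis
  proof (intro exI[of _ k] ballI)
    fix j assume "j \<in> J"
    then obtain i where i: "i < N" "f i = j"
      using f by (metis N_def bij_betw_iff_bijections lessThan_iff)
    have "\<bar>(of_int k * \<theta> j - \<alpha> j) - of_int (m i)\<bar> < \<eta>"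
      using km[OF i(1)] i by (simp add: \<phi>_def algebra_simps)
    then show "dist_int (of_int k * \<theta> j - \<alpha> j) < \<eta>"
      by (auto simp: dist_int_less_iff)
  qed
qed

section \<open>Bohr sets and well-spaced multiples\<close>

text \<open>By Kronecker's theorem there are shifts, one for each cell of a grid with \<open>m j\<close> cells in coordinate \<open>j\<close>,
  that move the cluster of points \<open>e * \<theta> j\<close>, \<open>e \<in> A\<close>, by the offset of that cell. The shifted copies of \<open>A\<close>
  are disjoint, and \<open>S\<close> bounds the total displacement.\<close>

lemma card_le_of_close_multiples:
  fixes m :: "'a \<Rightarrow> nat"
  assumes free: "free_mod_1 J \<theta>" and m: "\<And>j. j \<in> J \<Longrightarrow> m j > 0"
  shows "\<exists>S::nat. \<forall>u K. \<forall>A \<subseteq> {u<..u + K}.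
    (\<forall>e\<in>A. \<forall>e'\<in>A. \<forall>j\<in>J. dist_int ((real e - real e') * \<theta> j) < 1 / (2 * real (m j))) \<longrightarrow>
    card A * (\<Prod>j\<in>J. m j) \<le> K + S"
proof -
  have fin: "finite J"
    using free by (rule free_mod_1_finite)
  define C where "C = PiE J (\<lambda>j. {..<m j})"
  have C: "finite C" "card C = (\<Prod>j\<in>J. m j)"
    using fin by (auto simp: C_def card_PiE intro: finite_PiE)
  \<comment> \<open>Kronecker's theorem has one tolerance for all coordinates, so the finest grid
    sets it; the maximum requires J to be nonempty.\<close>
  have "\<exists>s::int. \<forall>j\<in>J. dist_int (of_int s * \<theta> j - real (c j) / real (m j)) < 1 / (4 * real (Max (m ` J)))" for c
  proof (cases "J = {}")
    case False
    then have "Max (m ` J) > 0"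
      using fin m by (simp add: Max_gr_iff) blast
    then show ?thesis
      by (intro Kronecker_free_mod_1[OF free]) auto
  qed auto
  moreover have "1 / (4 * real (Max (m ` J))) \<le> 1 / (4 * real (m j))" if "j \<in> J" for j
    using that fin m[OF that] Max_ge[of "m ` J" "m j"]
    by (intro divide_left_mono mult_left_mono mult_pos_pos) (auto simp del: Max_ge)
  ultimately have "\<exists>s::int. \<forall>j\<in>J. dist_int (of_int s * \<theta> j - real (c j) / real (m j)) < 1 / (4 * real (m j))" for c
    by (meson order_less_le_trans)
  then obtain s :: "('a \<Rightarrow> nat) \<Rightarrow> int" where
    s: "\<And>c j. j \<in> J \<Longrightarrow> dist_int (of_int (s c) * \<theta> j - real (c j) / real (m j)) < 1 / (4 * real (m j))"
    by metis
  define S where "S = (\<Sum>c\<in>C. nat \<bar>s c\<bar>)"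
  have S: "\<bar>s c\<bar> \<le> int S" if "c \<in> C" for c
  proof -
    have "nat \<bar>s c\<bar> \<le> S"
      unfolding S_def using C that by (intro member_le_sum) auto
    then show ?thesis by linarith
  qed
  show ?thesis
  proof (intro exI[of _ "2 * S"] allI impI)
    fix u K and A :: "nat set"
    assume A: "A \<subseteq> {u<..u + K}"
      and close: "\<forall>e\<in>A. \<forall>e'\<in>A. \<forall>j\<in>J. dist_int ((real e - real e') * \<theta> j) < 1 / (2 * real (m j))"
    define f where "f = (\<lambda>(e::nat, c). int e + s c)"
    have "inj_on f (A \<times> C)"
    proof (rule inj_onI, clarify)
      fix e c e' c'
      assume e: "e \<in> A" "c \<in> C" "e' \<in> A" "c' \<in> C" and eq: "f (e, c) = f (e', c')"
      have "c j = c' j" if j: "j \<in> J" for j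
      proof (rule ccontr)
        assume ne: "c j \<noteq> c' j"
        have lt: "c j < m j" "c' j < m j"
          using e j by (auto simp: C_def PiE_def)
        have "\<bar>int (c j) - int (c' j)\<bar> < int (m j)" "int (c j) - int (c' j) \<noteq> 0"
          using lt ne by auto
        then have nd: "\<not> int (m j) dvd (int (c j) - int (c' j))"
          using zdvd_not_zless[of "\<bar>int (c j) - int (c' j)\<bar>" "int (m j)"] by auto
        define a where "a = of_int (s c) * \<theta> j - real (c j) / real (m j)"
        define a' where "a' = of_int (s c') * \<theta> j - real (c' j) / real (m j)"
        have "real_of_int (int e + s c) = real_of_int (int e' + s c')"
          using eq by (simp add: f_def)
        then have "(real e - real e') * \<theta> j = (of_int (s c') - of_int (s c)) * \<theta> j"
          by simp
        then have "of_int (int (c j) - int (c' j)) / real (m j) = a' - a - (real e - real e') * \<theta> j"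
          by (simp add: a_def a'_def diff_divide_distrib left_diff_distrib)
        \<comment> \<open>Different cells are at least 1/m apart, a gap that two Kronecker errors
          and the spread of A together cannot bridge.\<close>
        then have "1 / real (m j) \<le> dist_int (a' - a - (real e - real e') * \<theta> j)"
          using dist_int_rational_ge[OF nd] by simp
        also have "\<dots> \<le> dist_int a' + dist_int a + dist_int ((real e - real e') * \<theta> j)"
          using dist_int_diff[of "a' - a" "(real e - real e') * \<theta> j"] dist_int_diff[of a' a] by linarith
        also have "\<dots> < 1 / (4 * real (m j)) + 1 / (4 * real (m j)) + 1 / (2 * real (m j))"
          using s[OF j, of c] s[OF j, of c'] close e j unfolding a_def a'_def
          by (intro add_strict_mono) auto
        also have "\<dots> = 1 / real (m j)"
          using m[OF j] by (simp add: field_simps)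
        finally show False by simp
      qed
      then have "c = c'"
        using e by (intro PiE_ext[of c J _ c']) (auto simp: C_def)
      with eq show "e = e' \<and> c = c'"
        by (simp add: f_def)
    qed
    moreover have "f ` (A \<times> C) \<subseteq> {int u - int S<..int u + int K + int S}"
    proof (rule image_subsetI, clarify)
      fix e c assume "e \<in> A" "c \<in> C"
      then show "f (e, c) \<in> {int u - int S<..int u + int K + int S}"
        using A S[of c] by (force simp: f_def)
    qed
    ultimately have "card (A \<times> C) \<le> card {int u - int S<..int u + int K + int S}"
      by (intro card_inj_on_le) auto
    also have "\<dots> = K + 2 * S"
      by simp
    finally show "card A * (\<Prod>j\<in>J. m j) \<le> K + 2 * S"
      by (simp add: C card_cartesian_product)
  qed
qed

definition Bohr :: "'a set \<Rightarrow> ('a \<Rightarrow> real) \<Rightarrow> real \<Rightarrow> nat \<Rightarrow> nat set"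
  where "Bohr J \<theta> \<delta> X = {d \<in> {X<..2 * X}. \<forall>j\<in>J. dist_int (real d * \<theta> j) < \<delta>}"

lemma finite_Bohr: "finite (Bohr J \<theta> \<delta> X)"
  by (simp add: Bohr_def)

text \<open>Dually to the upper bound, a shift for each cell moves every integer into the Bohr set, so these
  many translates cover.\<close>

lemma card_Bohr_ge:
  assumes free: "free_mod_1 J \<theta>" and m: "m > (0::nat)"
  shows "\<exists>S::nat. \<forall>X. X \<le> (16 * m) ^ card J * card (Bohr J \<theta> (1 / (4 * real m)) X) + S"
proof -
  have fin: "finite J"
    using free by (rule free_mod_1_finite)
  \<comment> \<open>The mesh 1/(16 m) is a quarter of the Bohr radius: rounding to a cell costs at
    most one mesh, the Kronecker shift less than two.\<close>
  define C where "C = PiE J (\<lambda>j. {..<16 * m})"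
  have C: "finite C" "card C = (16 * m) ^ card J"
    using fin by (auto simp: C_def card_PiE intro: finite_PiE)
  have "\<exists>s::int. \<forall>j\<in>J. dist_int (of_int s * \<theta> j - (- real (c j) / real (16 * m))) < 1 / (8 * real m)" for c
    using m by (intro Kronecker_free_mod_1[OF free]) auto
  then obtain s :: "('a \<Rightarrow> nat) \<Rightarrow> int" where
    s: "\<And>c j. j \<in> J \<Longrightarrow> dist_int (of_int (s c) * \<theta> j + real (c j) / real (16 * m)) < 1 / (8 * real m)"
    by (metis diff_minus_eq_add minus_divide_left)
  define S where "S = (\<Sum>c\<in>C. nat \<bar>s c\<bar>)"
  have S: "\<bar>s c\<bar> \<le> int S" if "c \<in> C" for c
  proof -
    have "nat \<bar>s c\<bar> \<le> S"
      unfolding S_def using C that by (intro member_le_sum) auto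
    then show ?thesis by linarith
  qed
  define cell where "cell e = restrict (\<lambda>j. nat \<lfloor>real (16 * m) * frac (real e * \<theta> j)\<rfloor>) J" for e :: nat
  have cell_C: "cell e \<in> C" for e
  proof -
    have "nat \<lfloor>real (16 * m) * frac (real e * \<theta> j)\<rfloor> < 16 * m" for j
    proof -
      have "real (16 * m) * frac (real e * \<theta> j) < real (16 * m)"
        using m frac_lt_1 by simp
      then show ?thesis
        using m by (simp add: nat_less_iff floor_less_iff)
    qed
    then show ?thesis
      by (auto simp: C_def cell_def)
  qed
  have cell_close: "dist_int (real e * \<theta> j - real (cell e j) / real (16 * m)) \<le> 1 / (16 * real m)" if "j \<in> J" for e j
  proof -
    define F where "F = frac (real e * \<theta> j)"
    have "0 \<le> real (16 * m) * F"
      by (simp add: F_def)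
    then have "real (cell e j) \<le> real (16 * m) * F" "real (16 * m) * F \<le> real (cell e j) + 1"
      using that by (simp_all add: cell_def F_def)
    then have "0 \<le> F - real (cell e j) / real (16 * m)" "F - real (cell e j) / real (16 * m) \<le> 1 / (16 * real m)"
    proof -
      define M where "M = real (16 * m)"
      have "M > 0" "1 / (16 * real m) = 1 / M"
        using m by (simp_all add: M_def)
      then show "0 \<le> F - real (cell e j) / real (16 * m)"
        "F - real (cell e j) / real (16 * m) \<le> 1 / (16 * real m)"
        using \<open>real (cell e j) \<le> real (16 * m) * F\<close> \<open>real (16 * m) * F \<le> real (cell e j) + 1\<close>
        mult_left_mono[of "F * M" "real (cell e j) + 1" M]
        by (simp_all flip: M_def add: field_simps)
    qed
    then have "\<bar>F - real (cell e j) / real (16 * m)\<bar> \<le> 1 / (16 * real m)"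
      by simp
    then show ?thesis
      using dist_int_le[of "real e * \<theta> j - real (cell e j) / real (16 * m)" "\<lfloor>real e * \<theta> j\<rfloor>"]
      by (simp add: F_def frac_def algebra_simps)
  qed
  show ?thesis
  proof (intro exI[of _ "2 * S"] allI)
    fix X
    let ?A = "Bohr J \<theta> (1 / (4 * real m)) X"
    define f where "f e = (cell e, nat (int e + s (cell e)))" for e
    have sub: "f ` {X + S<..2 * X - S} \<subseteq> C \<times> ?A"
    proof (rule image_subsetI)
      fix e assume e: "e \<in> {X + S<..2 * X - S}"
      define d where "d = nat (int e + s (cell e))"
      have d: "int d = int e + s (cell e)" "X < d" "d \<le> 2 * X"
        using e S[OF cell_C[of e]] by (auto simp: d_def)
      have "dist_int (real d * \<theta> j) < 1 / (4 * real m)" if j: "j \<in> J" for j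
      proof -
        have "real d = of_int (int e + s (cell e))"
          by (metis d(1) of_int_of_nat_eq)
        then have "real d * \<theta> j = (real e * \<theta> j - real (cell e j) / real (16 * m))
            + (of_int (s (cell e)) * \<theta> j + real (cell e j) / real (16 * m))" (is "_ = ?a + ?b")
          by (simp add: algebra_simps)
        then have "dist_int (real d * \<theta> j) \<le> dist_int (real e * \<theta> j - real (cell e j) / real (16 * m))
            + dist_int (of_int (s (cell e)) * \<theta> j + real (cell e j) / real (16 * m))"
          using dist_int_add[of ?a ?b] by (simp only:)
        also have "\<dots> < 1 / (16 * real m) + 1 / (8 * real m)"
          using cell_close[OF j] s[OF j] by (intro add_le_less_mono)
        also have "\<dots> \<le> 1 / (4 * real m)"
          using m by (simp add: field_simps)
        finally show ?thesis .
      qed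
      then show "f e \<in> C \<times> ?A"
        using cell_C d by (auto simp: f_def d_def Bohr_def)
    qed
    have inj: "inj_on f {X + S<..2 * X - S}"
    proof (rule inj_onI)
      fix e e' assume e: "e \<in> {X + S<..2 * X - S}" "e' \<in> {X + S<..2 * X - S}" and eq: "f e = f e'"
      then have "cell e = cell e'" by (simp add: f_def)
      then show "e = e'"
        using eq e S[OF cell_C[of e]] S[OF cell_C[of e']] by (auto simp: f_def)
    qed
    \<comment> \<open>The shortened interval has X - 2 S elements in truncated subtraction, so the
      final bound also holds when X < 2 S.\<close>
    have "card {X + S<..2 * X - S} \<le> card (C \<times> ?A)"
      using card_inj_on_le[OF inj sub] C finite_Bohr by blast
    then show "X \<le> (16 * m) ^ card J * card ?A + 2 * S"
      by (simp add: C(2) card_cartesian_product)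
  qed
qed

text \<open>A reduced fraction a/p within 1/p^2 of z lends its spacing to z: for k up to p/2 the
  error k/p^2 is at most half of the 1/p that separates k a/p from the integers. Irrationality
  provides such fractions with arbitrarily large p; h is p/2 rounded down.\<close>

lemma exists_well_spaced_multiples:
  assumes "z \<notin> \<rat>"
  shows "\<exists>h>N. \<forall>k. 0 < k \<and> k \<le> h \<longrightarrow> 1 / (8 * real h) \<le> dist_int (real k * z)"
proof -
  obtain a q where aq: "(a, q) \<in> approx_set z" and q: "q > 2 * int N + 2"
    using infinite_approx_set rational_iff_finite_approx_set assms by blast
  define p where "p = nat q"
  have p: "p > 2 * N + 2" and cop: "coprime a (int p)" and close: "\<bar>z - of_int a / real p\<bar> < 1 / (real p)\<^sup>2"
    using aq q by (auto simp: approx_set_def p_def)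
  define h where "h = p div 2"
  have h: "h > N" "2 * h \<le> p" "p \<le> 4 * h"
    using p by (auto simp: h_def)
  have "1 / (8 * real h) \<le> dist_int (real k * z)" if k: "0 < k" "k \<le> h" for k
  proof -
    have "\<not> int p dvd int k"
      using k h zdvd_not_zless[of "int k" "int p"] by auto
    then have "\<not> int p dvd (int k * a)"
      using cop by (simp add: coprime_commute coprime_dvd_mult_left_iff)
    then have 1: "1 / real p \<le> dist_int (of_int (int k * a) / real p)"
      by (rule dist_int_rational_ge)
    have "dist_int (real k * (of_int a / real p - z)) \<le> \<bar>real k * (of_int a / real p - z)\<bar>"
      using dist_int_le[of _ 0] by simp
    also have "\<dots> \<le> (real p / 2) * (1 / (real p)\<^sup>2)"
      unfolding abs_mult using close k h by (intro mult_mono) auto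
    also have "\<dots> = 1 / (2 * real p)"
      using p by (simp add: power2_eq_square)
    finally have "dist_int (real k * (of_int a / real p - z)) \<le> 1 / (2 * real p)" .
    moreover have "of_int (int k * a) / real p = real k * z + real k * (of_int a / real p - z)"
      by (simp add: algebra_simps)
    ultimately have "1 / real p - 1 / (2 * real p) \<le> dist_int (real k * z)"
      using 1 dist_int_add[of "real k * z" "real k * (of_int a / real p - z)"] by simp
    moreover have "1 / (8 * real h) \<le> 1 / real p - 1 / (2 * real p)"
      using p h by (simp add: field_simps)
    ultimately show ?thesis by linarith
  qed
  with h(1) show ?thesis by blast
qed

text \<open>Pigeonhole: the window meets at most K/h + 1 blocks of length h, and inside a block the
  residues \<open>r e\<close> lie in an interval of length 2 \<delta> and differ by at least 1/(8
  h). In contrast to \<open>card_le_of_close_multiples\<close> the bound is explicit, so \<delta>, h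
  and K may all vary together.\<close>

lemma card_le_of_well_spaced:
  fixes h :: nat
  assumes h: "h > 0" and spaced: "\<And>k. 0 < k \<Longrightarrow> k \<le> h \<Longrightarrow> 1 / (8 * real h) \<le> dist_int (real k * z)"
    and A: "A \<subseteq> {u<..u + K}" and \<delta>: "\<delta> > 0"
    and close: "\<And>e e'. e \<in> A \<Longrightarrow> e' \<in> A \<Longrightarrow> dist_int ((real e - real e') * z) < \<delta>"
  shows "real (card A) \<le> (real K / real h + 1) * (16 * real h * \<delta> + 1)"
proof (cases "A = {}")
  case True
  then show ?thesis using \<delta> by simp
next
  case False
  then obtain e0 where e0: "e0 \<in> A" by blast
  obtain k where k: "\<And>e. dist_int ((real e - real e0) * z) = \<bar>(real e - real e0) * z - of_int (k e)\<bar>"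
    using dist_int_attained[of "(real e - real e0) * z" for e] by metis
  define r where "r e = (real e - real e0) * z - of_int (k e)" for e
  have r: "\<bar>r e\<bar> < \<delta>" if "e \<in> A" for e
    using close[OF that e0] k[of e] by (simp add: r_def)
  define f where "f e = ((e - u - 1) div h, \<lfloor>(r e + \<delta>) * (8 * real h)\<rfloor>)" for e
  have inj: "inj_on f A"
  proof (rule linorder_inj_onI)
    fix e e' assume e: "e < e'" "e \<in> A" "e' \<in> A"
    show "f e \<noteq> f e'"
    proof
      assume eq: "f e = f e'"
      obtain a b where ab: "e = Suc (u + a)" "e' = Suc (u + b)"
        using e A by (metis greaterThanAtMost_iff less_iff_Suc_add subsetD)
      have "b < b div h * h + h"
        using h by (simp add: dividend_less_div_times add.commute)
      also have "b div h * h = a div h * h"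
        using eq by (simp add: f_def ab)
      also have "a div h * h + h \<le> a + h"
        by simp
      finally have "e' - e < h"
        using e(1) by (simp add: ab)
      then have "1 / (8 * real h) \<le> dist_int (real (e' - e) * z)"
        using e by (intro spaced) auto
      also have "real (e' - e) * z = (r e' - r e) + of_int (k e' - k e)"
        using e by (simp add: r_def of_nat_diff algebra_simps)
      also have "dist_int \<dots> \<le> \<bar>r e' - r e\<bar>"
        unfolding dist_int_add_int using dist_int_le[of _ 0] by simp
      finally have 1: "1 \<le> \<bar>r e' - r e\<bar> * (8 * real h)"
        using h by (simp add: field_simps)
      have "\<lfloor>(r e + \<delta>) * (8 * real h)\<rfloor> = \<lfloor>(r e' + \<delta>) * (8 * real h)\<rfloor>"
        using eq by (simp add: f_def)
      then have "\<bar>(r e' + \<delta>) * (8 * real h) - (r e + \<delta>) * (8 * real h)\<bar> < 1"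
        by linarith
      also have "(r e' + \<delta>) * (8 * real h) - (r e + \<delta>) * (8 * real h) = (r e' - r e) * (8 * real h)"
        by (simp add: algebra_simps)
      finally show False
        using 1 by (simp add: abs_mult)
    qed
  qed auto
  have sub: "f ` A \<subseteq> {..K div h} \<times> {0..\<lfloor>16 * real h * \<delta>\<rfloor>}"
  proof (rule image_subsetI)
    fix e assume e: "e \<in> A"
    have "e - u - 1 \<le> K" using subsetD[OF A e] by (simp, linarith)
    moreover have "0 \<le> (r e + \<delta>) * (8 * real h)"
      using r[OF e] by simp
    moreover have "(r e + \<delta>) * (8 * real h) \<le> (\<delta> + \<delta>) * (8 * real h)"
      using r[OF e] by (intro mult_right_mono) auto
    ultimately show "f e \<in> {..K div h} \<times> {0..\<lfloor>16 * real h * \<delta>\<rfloor>}"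
      by (auto simp: f_def div_le_mono algebra_simps intro!: floor_mono)
  qed
  have "card A \<le> card ({..K div h} \<times> {0..\<lfloor>16 * real h * \<delta>\<rfloor>})"
    using inj sub by (intro card_inj_on_le) auto
  also have "\<dots> = (K div h + 1) * nat (\<lfloor>16 * real h * \<delta>\<rfloor> + 1)"
    by simp
  finally have "real (card A) \<le> real ((K div h + 1) * nat (\<lfloor>16 * real h * \<delta>\<rfloor> + 1))"
    by (simp only: of_nat_le_iff)
  also have "\<dots> = (real (K div h) + 1) * (of_int \<lfloor>16 * real h * \<delta>\<rfloor> + 1)"
    using \<delta> by (simp add: of_nat_nat algebra_simps)
  also have "\<dots> \<le> (real K / real h + 1) * (16 * real h * \<delta> + 1)"
    using \<delta> of_nat_div_le_of_nat[of K h, where ?'a=real] by (intro mult_mono) auto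
  finally show ?thesis .
qed

section \<open>Overlaps over Bohr sets\<close>

lemma sum_inverse_squares_le:
  assumes "a > (0::nat)"
  shows "(\<Sum>g\<in>{a<..b}. 1 / (real g)\<^sup>2) \<le> 1 / real a"
proof -
  have "(\<Sum>g\<in>{a<..b}. 1 / (real g)\<^sup>2) \<le> 1 / real a - 1 / real b" if "a \<le> b"
    using that
  proof (induction b rule: dec_induct)
    case (step b)
    have "{a<..Suc b} = insert (Suc b) {a<..b}"
      using step by auto
    then have "(\<Sum>g\<in>{a<..Suc b}. 1 / (real g)\<^sup>2) = 1 / (real (Suc b))\<^sup>2 + (\<Sum>g\<in>{a<..b}. 1 / (real g)\<^sup>2)"
      by simp
    moreover have "1 / (real (Suc b))\<^sup>2 \<le> 1 / real b - 1 / real (Suc b)"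
    proof -
      have "b > 0" using step(1) assms by simp
      then have "1 / real b - 1 / real (Suc b) = 1 / (real b * real (Suc b))"
        by (simp add: field_simps)
      moreover have "1 / (real (Suc b))\<^sup>2 \<le> 1 / (real b * real (Suc b))"
        using \<open>b > 0\<close> by (intro divide_left_mono) (simp_all add: power2_eq_square)
      ultimately show ?thesis by simp
    qed
    ultimately show ?case
      using step by simp
  qed simp
  moreover have "0 \<le> 1 / real b" by simp
  ultimately show ?thesis
    by (cases "a \<le> b") (linarith, simp)
qed

lemma sum_inverse_squares_le_2: "(\<Sum>g\<in>{1..b::nat}. 1 / (real g)\<^sup>2) \<le> 2"
proof (cases "b = 0")
  case False
  then have "{1..b} = insert 1 {1<..b}" by auto
  then show ?thesis
    using sum_inverse_squares_le[of 1 b] by simp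
qed simp

text \<open>Cruder than a logarithm but sufficient: in \<open>sum_overlap_diagonal_le\<close> the
  range ends at 2 h^2 and the sum is multiplied by a term of order h, so a bound of order h is
  affordable.\<close>

lemma sum_inverse_le_sqrt: "(\<Sum>g\<in>{1..b::nat}. 1 / real g) \<le> 2 * sqrt (real b)"
proof (induction b)
  case (Suc b)
  have "sqrt (real b) * sqrt (real (Suc b)) \<le> real b + 1/2"
    using arith_geo_mean_sqrt[of "real b" "real (Suc b)"] by (simp add: real_sqrt_mult)
  then have "1 \<le> 2 * (sqrt (real (Suc b)) - sqrt (real b)) * sqrt (real (Suc b))"
    by (simp add: algebra_simps)
  also have "\<dots> \<le> 2 * (sqrt (real (Suc b)) - sqrt (real b)) * real (Suc b)"
    using real_sqrt_le_iff by (intro mult_left_mono) (auto simp: real_le_lsqrt power2_eq_square)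
  finally have "1 / real (Suc b) \<le> 2 * sqrt (real (Suc b)) - 2 * sqrt (real b)"
    by (simp add: field_simps)
  then show ?case
    using Suc by simp
qed simp

lemma divisors_subset:
  assumes "d \<in> {X<..2 * X::nat}"
  shows "{g. g dvd d} \<subseteq> {1..2 * X}"
  using assms dvd_imp_le by (force simp: Suc_le_eq intro: Nat.gr0I)

lemma sum_divisors_swap:
  fixes f :: "nat \<Rightarrow> real"
  assumes "D \<subseteq> {X<..2 * X}"
  shows "(\<Sum>d\<in>D. \<Sum>g | g dvd d. f g) = (\<Sum>g\<in>{1..2 * X}. f g * real (card {d \<in> D. g dvd d}))"
proof -
  have fin: "finite D" using assms finite_subset by blast
  have "(\<Sum>d\<in>D. \<Sum>g | g dvd d. f g) = (\<Sum>d\<in>D. \<Sum>g\<in>{1..2 * X}. if g dvd d then f g else 0)"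
  proof (rule sum.cong[OF refl])
    fix d assume "d \<in> D"
    then have "{g. g dvd d} = {g \<in> {1..2 * X}. g dvd d}"
      using divisors_subset assms by blast
    then show "(\<Sum>g | g dvd d. f g) = (\<Sum>g\<in>{1..2 * X}. if g dvd d then f g else 0)"
      by (simp only: sum.inter_filter[OF finite_atLeastAtMost])
  qed
  also have "\<dots> = (\<Sum>g\<in>{1..2 * X}. \<Sum>d\<in>D. if g dvd d then f g else 0)"
    by (rule sum.swap)
  also have "\<dots> = (\<Sum>g\<in>{1..2 * X}. f g * real (card {d \<in> D. g dvd d}))"
    using fin by (intro sum.cong refl) (simp add: sum.inter_filter[symmetric])
  finally show ?thesis .
qed

text \<open>For D inside (X, 2 X] and g > 0 the window is automatic: g e > X gives e > X div g, and
  g e <= 2 X < 2 g (X div g + 1) gives e <= 2 (X div g) + 1. Intersecting with it keeps the set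
  finite in all cases.\<close>

definition quotients :: "nat \<Rightarrow> nat set \<Rightarrow> nat \<Rightarrow> nat set"
  where "quotients X D g = {e. g * e \<in> D} \<inter> {X div g<..X div g + (X div g + 1)}"

lemma multiples_eq_quotients:
  assumes D: "D \<subseteq> {X<..2 * X}" and g: "g > 0"
  shows "{d \<in> D. g dvd d \<and> P (d div g)} = (*) g ` {e \<in> quotients X D g. P e}"
proof (intro equalityI subsetI)
  fix d assume d: "d \<in> {d \<in> D. g dvd d \<and> P (d div g)}"
  then obtain e where e: "d = g * e" by (auto elim: dvdE)
  have "X div g < e"
    using d D g e by (auto simp: div_less_iff_less_mult mult.commute)
  moreover have "e \<le> X div g + (X div g + 1)"
  proof -
    have "g * e \<le> 2 * X"
      using d D e by auto
    also have "X < g * (X div g + 1)"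
      using g by (metis Suc_eq_plus1 dividend_less_times_div mult_Suc_right)
    then have "2 * X < g * (2 * (X div g + 1))"
      by (simp add: algebra_simps)
    finally have "e < 2 * (X div g + 1)"
      by (simp only: mult_less_cancel1)
    then show ?thesis by simp
  qed
  ultimately show "d \<in> (*) g ` {e \<in> quotients X D g. P e}"
    using d e g by (auto simp: quotients_def)
qed (use g in \<open>auto simp: quotients_def\<close>)

lemma card_multiples_eq:
  assumes "D \<subseteq> {X<..2 * X}" and "g > 0"
  shows "card {d \<in> D. g dvd d \<and> P (d div g)} = card {e \<in> quotients X D g. P e}"
  unfolding multiples_eq_quotients[OF assms] using assms(2)
  by (intro card_image) (auto simp: inj_on_def)

lemma card_multiples_le:
  assumes D: "D \<subseteq> {X<..2 * X}" and g: "g \<in> {1..2 * X}"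
  shows "real (card {d \<in> D. g dvd d}) \<le> 3 * real X / real g"
proof -
  have "card {d \<in> D. g dvd d} = card (quotients X D g)"
    using card_multiples_eq[OF D, of g "\<lambda>_. True"] g by simp
  also have "\<dots> \<le> card {X div g<..X div g + (X div g + 1)}"
    by (intro card_mono) (auto simp: quotients_def)
  finally have "real (card {d \<in> D. g dvd d}) \<le> real (X div g) + 1"
    by simp
  also have "\<dots> \<le> real X / real g + 2 * real X / real g"
    using g of_nat_div_le_of_nat[of X g, where ?'a=real] by (intro add_mono) (auto simp: field_simps)
  finally show ?thesis by simp
qed

section \<open>Overlaps of pairs, sorted by common divisor\<close>

definition close_pair :: "real \<Rightarrow> real \<Rightarrow> nat \<Rightarrow> nat \<Rightarrow> bool"
  where "close_pair z \<epsilon> d d' \<longleftrightarrow>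
    dist_int ((real d - real d') / real (gcd d d') * z) < 2 * \<epsilon> / real (gcd d d')"

text \<open>Models the measure of the intersection of two hits, with the factor 6 \<epsilon> of
  \<open>measure_hit_Int_le\<close> taken out; what remains is purely arithmetic.\<close>

definition overlap :: "real \<Rightarrow> real \<Rightarrow> nat \<Rightarrow> nat \<Rightarrow> real"
  where "overlap z \<epsilon> d d' = (if close_pair z \<epsilon> d d' then real (gcd d d') / (real d * real d') else 0)"

lemma overlap_nonneg: "0 \<le> overlap z \<epsilon> d d'"
  by (simp add: overlap_def)

lemma overlap_commute: "overlap z \<epsilon> d d' = overlap z \<epsilon> d' d"
proof -
  have "(real d' - real d) / real (gcd d d') * z = - ((real d - real d') / real (gcd d d') * z)"
    by (simp add: diff_divide_distrib left_diff_distrib)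
  then have "dist_int ((real d' - real d) / real (gcd d d') * z) = dist_int ((real d - real d') / real (gcd d d') * z)"
    by (simp only: dist_int_uminus)
  then show ?thesis
    by (simp add: overlap_def close_pair_def gcd.commute[of d' d] mult.commute)
qed

definition close_quotients :: "real \<Rightarrow> real \<Rightarrow> nat \<Rightarrow> nat \<Rightarrow> nat set \<Rightarrow> nat \<Rightarrow> nat set"
  where "close_quotients z \<epsilon> d X D g =
    {e \<in> quotients X D g. dist_int ((real (d div g) - real e) * z) < 2 * \<epsilon> / real g}"

lemma close_quotients_subset: "close_quotients z \<epsilon> d X D g \<subseteq> {X div g<..X div g + (X div g + 1)}"
  by (auto simp: close_quotients_def quotients_def)

lemma close_quotients_close:
  assumes "e \<in> close_quotients z \<epsilon> d X D g" "e' \<in> close_quotients z \<epsilon> d X D g"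
  shows "dist_int ((real e - real e') * z) < 4 * \<epsilon> / real g"
proof -
  have "(real e - real e') * z = (real (d div g) - real e') * z - (real (d div g) - real e) * z"
    by (simp add: algebra_simps)
  then have "dist_int ((real e - real e') * z)
      \<le> dist_int ((real (d div g) - real e') * z) + dist_int ((real (d div g) - real e) * z)"
    using dist_int_diff by metis
  also have "\<dots> < 2 * \<epsilon> / real g + 2 * \<epsilon> / real g"
    using assms by (intro add_strict_mono) (auto simp: close_quotients_def)
  finally show ?thesis by simp
qed

text \<open>The condition gcd(d, d') = g is relaxed to g dividing both, so a pair may be counted for
  several g. An upper bound tolerates this, and for each g there remains a count of quotients e =
  d'/g with e z close to (d/g) z modulo 1. In the denominator d' is replaced by the smaller
  X.\<close>

lemma sum_overlap_le:
  assumes d: "d > 0" and D: "D \<subseteq> {X<..2 * X}"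
  shows "(\<Sum>d'\<in>D. overlap z \<epsilon> d d')
    \<le> (\<Sum>g | g dvd d. real g / (real d * real X) * real (card (close_quotients z \<epsilon> d X D g)))"
proof -
  have fin: "finite D" using D finite_subset by blast
  have findvd: "finite {g. g dvd d}" using d by simp
  define P where "P g d' \<longleftrightarrow> g dvd d' \<and> dist_int ((real (d div g) - real (d' div g)) * z) < 2 * \<epsilon> / real g" for g d'
  have "overlap z \<epsilon> d d' \<le> (\<Sum>g | g dvd d. if P g d' then real g / (real d * real X) else 0)" if d': "d' \<in> D" for d'
  proof (cases "close_pair z \<epsilon> d d'")
    case True
    let ?g = "gcd d d'"
    have X: "X < d'" "X > 0" using D d' by auto
    have "(real d - real d') / real ?g = real (d div ?g) - real (d' div ?g)"
      by (simp add: real_of_nat_div diff_divide_distrib)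
    then have P: "P ?g d'"
      using True by (simp add: P_def close_pair_def)
    have "overlap z \<epsilon> d d' \<le> real ?g / (real d * real X)"
      using True d X unfolding overlap_def by (auto intro!: divide_left_mono mult_left_mono)
    also have "\<dots> = (if P ?g d' then real ?g / (real d * real X) else 0)"
      using P by simp
    also have "\<dots> \<le> (\<Sum>g | g dvd d. if P g d' then real g / (real d * real X) else 0)"
      using findvd by (intro member_le_sum[of ?g _ "\<lambda>g. if P g d' then real g / (real d * real X) else 0"]) auto
    finally show ?thesis .
  qed (auto simp: overlap_def intro!: sum_nonneg)
  then have "(\<Sum>d'\<in>D. overlap z \<epsilon> d d') \<le> (\<Sum>d'\<in>D. \<Sum>g | g dvd d. if P g d' then real g / (real d * real X) else 0)"
    by (rule sum_mono)
  also have "\<dots> = (\<Sum>g | g dvd d. \<Sum>d'\<in>D. if P g d' then real g / (real d * real X) else 0)"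
    by (rule sum.swap)
  also have "\<dots> = (\<Sum>g | g dvd d. real g / (real d * real X) * real (card {d' \<in> D. P g d'}))"
    using fin by (intro sum.cong refl) (simp add: sum.inter_filter[symmetric])
  also have "\<dots> = (\<Sum>g | g dvd d. real g / (real d * real X) * real (card (close_quotients z \<epsilon> d X D g)))"
    using d card_multiples_eq[OF D, of _ "\<lambda>e. dist_int ((real (d div _) - real e) * z) < 2 * \<epsilon> / real _"]
    by (intro sum.cong refl) (auto simp: P_def close_quotients_def card_multiples_eq[OF D] dvd_pos_nat)
  finally show ?thesis .
qed

text \<open>The choice X = h^2 balances the count: a window of quotients meets about X/(g h) + 1
  blocks of length h, so each term of \<open>c g\<close>, summed over g up to 2 X, is O(X), and the
  prefactor 3/X cancels this.\<close>

lemma sum_overlap_diagonal_le: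
  fixes h :: nat
  assumes h: "h > 0" and spaced: "\<And>k. 0 < k \<Longrightarrow> k \<le> h \<Longrightarrow> 1 / (8 * real h) \<le> dist_int (real k * z)"
    and \<epsilon>: "0 < \<epsilon>" "\<epsilon> \<le> 1 / 8" and D: "D \<subseteq> {h\<^sup>2<..2 * h\<^sup>2}"
  shows "(\<Sum>d\<in>D. \<Sum>d'\<in>D. overlap z \<epsilon> d d') \<le> 249"
proof -
  define X where "X = h\<^sup>2"
  have D: "D \<subseteq> {X<..2 * X}" and X: "X > 0" "real X = real h * real h"
    using D h by (auto simp: X_def power2_eq_square)
  \<comment> \<open>The expansion of (3 h/g + 1) (64 \<epsilon> h/g + 1) with h^2 = X.\<close>
  define c where "c g = 192 * \<epsilon> * (real X * (1 / (real g)\<^sup>2)) + (3 * real h + 64 * \<epsilon> * real h) * (1 / real g) + 1" for g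
  have cq: "real (card (close_quotients z \<epsilon> d X D g)) \<le> c g" if g: "g \<in> {1..2 * X}" for d g
  proof -
    have "4 * \<epsilon> / real g > 0" using g \<epsilon> by simp
    then have "real (card (close_quotients z \<epsilon> d X D g))
        \<le> (real (X div g + 1) / real h + 1) * (16 * real h * (4 * \<epsilon> / real g) + 1)"
      using close_quotients_close
      by (intro card_le_of_well_spaced[OF h spaced close_quotients_subset]) auto
    also have "\<dots> \<le> (3 * real h / real g + 1) * (16 * real h * (4 * \<epsilon> / real g) + 1)"
    proof (rule mult_right_mono)
      have "real (X div g + 1) \<le> real X / real g + 2 * real X / real g"
        using g of_nat_div_le_of_nat[of X g, where ?'a=real] unfolding of_nat_add
        by (intro add_mono) (auto simp: field_simps)
      also have "\<dots> = 3 * real h / real g * real h"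
        by (simp add: X)
      finally show "real (X div g + 1) / real h + 1 \<le> 3 * real h / real g + 1"
        using h by (simp add: pos_divide_le_eq)
    qed (use \<epsilon> in auto)
    also have "\<dots> = c g"
      by (simp add: c_def X power2_eq_square algebra_simps add_divide_distrib)
    finally show ?thesis .
  qed
  have c_nonneg: "c g \<ge> 0" for g
    using \<epsilon> by (simp add: c_def)
  have "(\<Sum>d\<in>D. \<Sum>d'\<in>D. overlap z \<epsilon> d d')
      \<le> (\<Sum>d\<in>D. \<Sum>g | g dvd d. real g / (real X)\<^sup>2 * c g)"
  proof (rule sum_mono)
    fix d assume d: "d \<in> D"
    then have d': "d \<in> {X<..2 * X}"
      using D by blast
    then have dX: "X < d" and dvd: "\<And>g. g dvd d \<Longrightarrow> g \<in> {1..2 * X}"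
      using divisors_subset[OF d'] by auto
    have "d > 0" using dX X by (auto intro: gr0I)
    then have "(\<Sum>d'\<in>D. overlap z \<epsilon> d d')
      \<le> (\<Sum>g | g dvd d. real g / (real d * real X) * real (card (close_quotients z \<epsilon> d X D g)))"
      using D by (rule sum_overlap_le)
    also have "\<dots> \<le> (\<Sum>g | g dvd d. real g / (real X)\<^sup>2 * c g)"
    proof (rule sum_mono, rule mult_mono)
      fix g assume "g \<in> {g. g dvd d}"
      then show "real g / (real d * real X) \<le> real g / (real X)\<^sup>2"
        using dX X(1) \<open>d > 0\<close> unfolding power2_eq_square
        by (intro divide_left_mono mult_right_mono) auto
      show "real (card (close_quotients z \<epsilon> d X D g)) \<le> c g"
        using cq dvd \<open>g \<in> {g. g dvd d}\<close> by blast
    qed auto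
    finally show "(\<Sum>d'\<in>D. overlap z \<epsilon> d d') \<le> (\<Sum>g | g dvd d. real g / (real X)\<^sup>2 * c g)" .
  qed
  also have "\<dots> = (\<Sum>g\<in>{1..2 * X}. real g / (real X)\<^sup>2 * c g * real (card {d \<in> D. g dvd d}))"
    using D by (rule sum_divisors_swap)
  also have "\<dots> \<le> (\<Sum>g\<in>{1..2 * X}. 3 / real X * c g)"
  proof (rule sum_mono)
    fix g assume g: "g \<in> {1..2 * X}"
    have "real g / (real X)\<^sup>2 * c g * real (card {d \<in> D. g dvd d}) \<le> real g / (real X)\<^sup>2 * c g * (3 * real X / real g)"
      using card_multiples_le[OF D g] c_nonneg by (intro mult_left_mono) auto
    also have "\<dots> = 3 / real X * c g"
      using g X(1) by (simp add: field_simps power2_eq_square)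
    finally show "real g / (real X)\<^sup>2 * c g * real (card {d \<in> D. g dvd d}) \<le> 3 / real X * c g" .
  qed
  also have "\<dots> = 3 / real X * (\<Sum>g\<in>{1..2 * X}. c g)"
    by (simp add: sum_distrib_left)
  also have "(\<Sum>g\<in>{1..2 * X}. c g) = 192 * \<epsilon> * (real X * (\<Sum>g\<in>{1..2 * X}. 1 / (real g)\<^sup>2))
      + (3 * real h + 64 * \<epsilon> * real h) * (\<Sum>g\<in>{1..2 * X}. 1 / real g) + 2 * real X"
    by (simp add: c_def sum.distrib sum_distrib_left)
  also have "\<dots> \<le> 192 * \<epsilon> * (real X * 2) + (3 * real h + 64 * \<epsilon> * real h) * (3 * real h) + 2 * real X"
  proof -
    have "(\<Sum>g\<in>{1..2 * X}. 1 / real g) \<le> 2 * sqrt (real (2 * X))"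
      by (rule sum_inverse_le_sqrt)
    also have "\<dots> \<le> 2 * (3 / 2 * real h)"
      using X by (intro mult_left_mono real_le_lsqrt) (auto simp: power2_eq_square)
    finally have "(\<Sum>g\<in>{1..2 * X}. 1 / real g) \<le> 3 * real h" by simp
    then show ?thesis
      using sum_inverse_squares_le_2 \<epsilon> by (intro add_mono mult_left_mono) auto
  qed
  also have "\<dots> = real X * (576 * \<epsilon> + 11)"
    by (simp add: X algebra_simps)
  also have "3 / real X * \<dots> = 3 * (576 * \<epsilon> + 11)"
    using X(1) by simp
  \<comment> \<open>With \<epsilon> at most 1/8 the value is at most 3 (72 + 11).\<close>
  also have "\<dots> \<le> 249"
    using \<epsilon> by simp
  finally show ?thesis
    using X(1) by (simp add: divide_right_mono)
qed

text \<open>This is sigma(d)/d^2 for the sum-of-divisors function: each divisor g of d contributes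
  1/(d g), the order of the overlap that d has through g with a later block.\<close>

definition divisor_weight :: "nat \<Rightarrow> real"
  where "divisor_weight d = (\<Sum>g | g dvd d. 1 / real g) / real d"

text \<open>Divisibility by g does not spoil the gain from the Bohr condition: the quotients e
  satisfy a Bohr condition for the family \<open>g * \<theta> j\<close>, which is again free. The
  error S depends on g.\<close>

lemma card_quotients_Bohr_le:
  assumes free: "free_mod_1 J \<theta>" and m: "m > (0::nat)" and g: "g > (0::nat)"
  shows "\<exists>S::nat. \<forall>X. card (quotients X (Bohr J \<theta> (1 / (4 * real m)) X) g) * m ^ card J \<le> X div g + S"
proof -
  have "free_mod_1 J (\<lambda>j. of_int (int g) * \<theta> j)"
    using g by (intro free_mod_1_scale[OF free]) auto
  from card_le_of_close_multiples[OF this, of "\<lambda>_. m"] m obtain S :: nat where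
    S: "\<And>u K A. A \<subseteq> {u<..u + K} \<Longrightarrow>
    (\<forall>e\<in>A. \<forall>e'\<in>A. \<forall>j\<in>J. dist_int ((real e - real e') * (of_int (int g) * \<theta> j)) < 1 / (2 * real m)) \<Longrightarrow>
    card A * m ^ card J \<le> K + S"
    by (auto simp: prod_constant)
  show ?thesis
  proof (intro exI[of _ "1 + S"] allI)
    fix X
    let ?A = "quotients X (Bohr J \<theta> (1 / (4 * real m)) X) g"
    have "card ?A * m ^ card J \<le> (X div g + 1) + S"
    proof (rule S)
      show "?A \<subseteq> {X div g<..X div g + (X div g + 1)}"
        by (auto simp: quotients_def)
      show "\<forall>e\<in>?A. \<forall>e'\<in>?A. \<forall>j\<in>J. dist_int ((real e - real e') * (of_int (int g) * \<theta> j)) < 1 / (2 * real m)"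
      proof (intro ballI)
        fix e e' j assume "e \<in> ?A" "e' \<in> ?A" "j \<in> J"
        then have "dist_int (real (g * e) * \<theta> j) < 1 / (4 * real m)" "dist_int (real (g * e') * \<theta> j) < 1 / (4 * real m)"
          by (auto simp: quotients_def Bohr_def)
        moreover have "dist_int ((real e - real e') * (of_int (int g) * \<theta> j))
            = dist_int (real (g * e) * \<theta> j - real (g * e') * \<theta> j)"
          by (simp add: algebra_simps)
        moreover have "1 / (4 * real m) + 1 / (4 * real m) = 1 / (2 * real m)"
          using m by (simp add: field_simps)
        ultimately show "dist_int ((real e - real e') * (of_int (int g) * \<theta> j)) < 1 / (2 * real m)"
          using dist_int_diff[of "real (g * e) * \<theta> j" "real (g * e') * \<theta> j"] by linarith
      qed
    qed
    then show "card ?A * m ^ card J \<le> X div g + (1 + S)" by simp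
  qed
qed

lemma sum_divisor_weight_Bohr_le:
  assumes free: "free_mod_1 J \<theta>" and m: "m > (0::nat)"
  shows "\<forall>\<^sub>F X in sequentially.
    (\<Sum>d\<in>Bohr J \<theta> (1 / (4 * real m)) X. divisor_weight d) \<le> 4 / real m ^ card J"
proof -
  define B where "B = Bohr J \<theta> (1 / (4 * real m))"
  define M where "M = real m ^ card J"
  have M: "M \<ge> 1" using m by (simp add: M_def)
  obtain S :: "nat \<Rightarrow> nat" where
    S: "\<And>g X. g > 0 \<Longrightarrow> card (quotients X (B X) g) * m ^ card J \<le> X div g + S g"
    using card_quotients_Bohr_le[OF free m] unfolding B_def by metis
  \<comment> \<open>As the error S depends on g, the density bound serves only finitely many g.
    Beyond G = 3 M the trivial count of multiples suffices, because the tail of 3/g^2 sums to at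
    most 3/G = 1/M.\<close>
  define G where "G = 3 * m ^ card J"
  have G: "G > 0" "real G = 3 * M" using m by (auto simp: G_def M_def)
  have "(\<Sum>d\<in>B X. divisor_weight d) \<le> 4 / M" if X: "X \<ge> (\<Sum>g\<in>{1..G}. S g) + 1" for X
  proof -
    have sub: "B X \<subseteq> {X<..2 * X}"
      by (auto simp: B_def Bohr_def)
    have X0: "X > 0" using X by simp
    have "(\<Sum>d\<in>B X. divisor_weight d) \<le> (\<Sum>d\<in>B X. \<Sum>g | g dvd d. 1 / (real g * real X))"
    proof (rule sum_mono)
      fix d assume "d \<in> B X"
      then have "X < d" using sub by auto
      then have "divisor_weight d \<le> (\<Sum>g | g dvd d. 1 / real g) / real X"
        unfolding divisor_weight_def using X0 by (intro divide_left_mono sum_nonneg) auto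
      then show "divisor_weight d \<le> (\<Sum>g | g dvd d. 1 / (real g * real X))"
        by (simp add: sum_divide_distrib)
    qed
    also have "\<dots> = (\<Sum>g\<in>{1..2 * X}. 1 / (real g * real X) * real (card {d \<in> B X. g dvd d}))"
      using sub by (rule sum_divisors_swap)
    also have "\<dots> \<le> (\<Sum>g\<in>{1..2 * X}. 1 / M * (1 / (real g)\<^sup>2) + (if g \<in> {1..G} then real (S g) / (M * real X) else 0)
        + (if g \<in> {G<..2 * X} then 3 * (1 / (real g)\<^sup>2) else 0))"
    proof (rule sum_mono)
      fix g assume g: "g \<in> {1..2 * X}"
      show "1 / (real g * real X) * real (card {d \<in> B X. g dvd d}) \<le> 1 / M * (1 / (real g)\<^sup>2)
        + (if g \<in> {1..G} then real (S g) / (M * real X) else 0) + (if g \<in> {G<..2 * X} then 3 * (1 / (real g)\<^sup>2) else 0)"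
      proof (cases "g \<le> G")
        case True
        have "card {d \<in> B X. g dvd d} = card (quotients X (B X) g)"
          using card_multiples_eq[OF sub, of g "\<lambda>_. True"] g by simp
        then have "real (card {d \<in> B X. g dvd d}) * M = real (card (quotients X (B X) g) * m ^ card J)"
          by (simp add: M_def)
        also have "\<dots> \<le> real (X div g + S g)"
          using g by (intro of_nat_mono S) auto
        also have "\<dots> \<le> real X / real g + real (S g)"
          using of_nat_div_le_of_nat[of X g, where ?'a=real] by simp
        finally have "real (card {d \<in> B X. g dvd d}) \<le> (real X / real g + real (S g)) / M"
          using M by (simp add: pos_le_divide_eq)
        then have "1 / (real g * real X) * real (card {d \<in> B X. g dvd d}) \<le> 1 / (real g * real X) * ((real X / real g + real (S g)) / M)"
          by (intro mult_left_mono) auto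
        also have "\<dots> = 1 / M * (1 / (real g)\<^sup>2) + 1 / real g * (real (S g) / (M * real X))"
          using X0 g M by (simp add: field_simps power2_eq_square)
        also have "1 / real g * (real (S g) / (M * real X)) \<le> 1 * (real (S g) / (M * real X))"
          using g M by (intro mult_right_mono) auto
        finally show ?thesis
          using True g by simp
      next
        case False
        have "1 / (real g * real X) * real (card {d \<in> B X. g dvd d}) \<le> 1 / (real g * real X) * (3 * real X / real g)"
          using card_multiples_le[OF sub g] by (intro mult_left_mono) auto
        also have "\<dots> = 3 * (1 / (real g)\<^sup>2)"
          using X0 by (simp add: power2_eq_square)
        finally show ?thesis
          using False g M by (simp add: add_increasing)
      qed
    qed
    also have "\<dots> = 1 / M * (\<Sum>g\<in>{1..2 * X}. 1 / (real g)\<^sup>2)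
        + (\<Sum>g\<in>{1..2 * X}. if g \<in> {1..G} then real (S g) / (M * real X) else 0)
        + (\<Sum>g\<in>{1..2 * X}. if g \<in> {G<..2 * X} then 3 * (1 / (real g)\<^sup>2) else 0)"
      by (simp only: sum.distrib sum_distrib_left)
    also have "\<dots> \<le> 1 / M * 2 + 1 / M + 1 / M"
    proof (intro add_mono mult_left_mono sum_inverse_squares_le_2)
      have "(\<Sum>g\<in>{1..2 * X}. if g \<in> {1..G} then real (S g) / (M * real X) else 0)
          = (\<Sum>g\<in>{1..2 * X} \<inter> {1..G}. real (S g) / (M * real X))"
        by (rule sum.inter_restrict[symmetric]) simp
      also have "\<dots> \<le> (\<Sum>g\<in>{1..G}. real (S g) / (M * real X))"
        using M by (intro sum_mono2) auto
      also have "\<dots> = real (\<Sum>g\<in>{1..G}. S g) / (M * real X)"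
        by (simp add: sum_divide_distrib)
      also have "\<dots> \<le> real X / (M * real X)"
        using X M by (intro divide_right_mono of_nat_mono) auto
      also have "\<dots> = 1 / M" using X0 by simp
      finally show "(\<Sum>g\<in>{1..2 * X}. if g \<in> {1..G} then real (S g) / (M * real X) else 0) \<le> 1 / M" .
      have "(\<Sum>g\<in>{1..2 * X}. if g \<in> {G<..2 * X} then 3 * (1 / (real g)\<^sup>2) else 0)
          = (\<Sum>g\<in>{1..2 * X} \<inter> {G<..2 * X}. 3 * (1 / (real g)\<^sup>2))"
        by (rule sum.inter_restrict[symmetric]) simp
      also have "\<dots> \<le> (\<Sum>g\<in>{G<..2 * X}. 3 * (1 / (real g)\<^sup>2))"
        by (intro sum_mono2) auto
      also have "\<dots> = 3 * (\<Sum>g\<in>{G<..2 * X}. 1 / (real g)\<^sup>2)"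
        by (simp only: sum_distrib_left)
      also have "\<dots> \<le> 3 * (1 / real G)"
        using sum_inverse_squares_le[OF G(1)] by (intro mult_left_mono) auto
      also have "\<dots> = 1 / M" by (simp add: G)
      finally show "(\<Sum>g\<in>{1..2 * X}. if g \<in> {G<..2 * X} then 3 * (1 / (real g)\<^sup>2) else 0) \<le> 1 / M" .
    qed (use M in auto)
    finally show ?thesis by simp
  qed
  then show ?thesis
    unfolding eventually_sequentially B_def M_def by blast
qed

text \<open>For fixed d, closeness to d adds one coordinate, the multiples of
  \<open>\<theta> k\<close>, to the Bohr conditions on the quotients e. The count has main term X/(n
  g^2 m^r) with r = card J. Only the finitely many divisors g of d occur, so for large X the
  Kronecker errors at most double it.\<close>

lemma sum_overlap_Bohr_le:
  assumes free: "free_mod_1 (insert k J) \<theta>" and k: "k \<notin> J"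
    and m: "m > (0::nat)" and n: "n > (0::nat)" and d: "d > 0"
  shows "\<forall>\<^sub>F X in sequentially. (\<Sum>d'\<in>Bohr J \<theta> (1 / (4 * real m)) X. overlap (\<theta> k) (1 / (8 * real n)) d d')
    \<le> 2 / (real n * real m ^ card J) * divisor_weight d"
proof -
  define B where "B = Bohr J \<theta> (1 / (4 * real m))"
  define \<epsilon> where "\<epsilon> = 1 / (8 * real n)"
  define M where "M = real m ^ card J"
  have M: "M > 0" using m by (simp add: M_def)
  have fin: "finite J"
    using free_mod_1_finite[OF free] by simp
  have "\<exists>S::nat. \<forall>X. real (card (close_quotients (\<theta> k) \<epsilon> d X (B X) g)) * (M * (real n * real g)) \<le> real X / real g + real S"
    if g: "g > 0" for g
  proof -
    \<comment> \<open>The Bohr condition concerns g e, the closeness condition e itself, so only the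
      coordinates in J are scaled by g.\<close>
    define \<phi> where "\<phi> j = of_int (if j = k then 1 else int g) * \<theta> j" for j
    have "free_mod_1 (insert k J) \<phi>"
      unfolding \<phi>_def using g by (intro free_mod_1_scale[OF free]) auto
    moreover have "(\<Prod>j\<in>insert k J. if j = k then n * g else m) = m ^ card J * (n * g)"
    proof -
      have "(\<Prod>j\<in>J. if j = k then n * g else m) = m ^ card J"
        using k by (subst prod.cong[of J J _ "\<lambda>_. m"]) auto
      then show ?thesis
        using fin k by simp
    qed
    moreover have "(if j = k then n * g else m) > 0" for j
      using m n g by simp
    ultimately obtain S :: nat where
      S: "\<And>u K A. A \<subseteq> {u<..u + K} \<Longrightarrow>
      (\<forall>e\<in>A. \<forall>e'\<in>A. \<forall>j\<in>insert k J. dist_int ((real e - real e') * \<phi> j) < 1 / (2 * real (if j = k then n * g else m))) \<Longrightarrow>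
      card A * (m ^ card J * (n * g)) \<le> K + S"
      using card_le_of_close_multiples[of "insert k J" \<phi> "\<lambda>j. if j = k then n * g else m"] by metis
    show ?thesis
    proof (intro exI[of _ "1 + S"] allI)
      fix X
      let ?A = "close_quotients (\<theta> k) \<epsilon> d X (B X) g"
      have "card ?A * (m ^ card J * (n * g)) \<le> (X div g + 1) + S"
      proof (rule S)
        show "?A \<subseteq> {X div g<..X div g + (X div g + 1)}"
          by (rule close_quotients_subset)
        show "\<forall>e\<in>?A. \<forall>e'\<in>?A. \<forall>j\<in>insert k J. dist_int ((real e - real e') * \<phi> j) < 1 / (2 * real (if j = k then n * g else m))"
        proof (intro ballI)
          fix e e' j assume e: "e \<in> ?A" "e' \<in> ?A" and j: "j \<in> insert k J"
          show "dist_int ((real e - real e') * \<phi> j) < 1 / (2 * real (if j = k then n * g else m))"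
          proof (cases "j = k")
            case True
            \<comment> \<open>By \<epsilon> = 1/(8 n) the allowed spread is half a cell of a grid
              with n g cells.\<close>
            have "4 * \<epsilon> / real g = 1 / (2 * real (n * g))"
              using n g by (simp add: \<epsilon>_def)
            then show ?thesis
              using close_quotients_close[OF e] True by (simp add: \<phi>_def)
          next
            case False
            with e j have "dist_int (real (g * e) * \<theta> j) < 1 / (4 * real m)" "dist_int (real (g * e') * \<theta> j) < 1 / (4 * real m)"
              by (auto simp: close_quotients_def quotients_def B_def Bohr_def)
            moreover have "dist_int ((real e - real e') * \<phi> j) = dist_int (real (g * e) * \<theta> j - real (g * e') * \<theta> j)"
              using False by (simp add: \<phi>_def algebra_simps)
            moreover have "1 / (4 * real m) + 1 / (4 * real m) = 1 / (2 * real m)"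
              using m by (simp add: field_simps)
            ultimately show ?thesis
              using False dist_int_diff[of "real (g * e) * \<theta> j" "real (g * e') * \<theta> j"] by simp
          qed
        qed
      qed
      then have "real (card ?A * (m ^ card J * (n * g))) \<le> real ((X div g + 1) + S)"
        by (simp only: of_nat_le_iff)
      then show "real (card ?A) * (M * (real n * real g)) \<le> real X / real g + real (1 + S)"
        using of_nat_div_le_of_nat[of X g, where ?'a=real] by (simp add: M_def)
    qed
  qed
  then obtain S :: "nat \<Rightarrow> nat" where
    S: "\<And>g X. g > 0 \<Longrightarrow> real (card (close_quotients (\<theta> k) \<epsilon> d X (B X) g)) * (M * (real n * real g)) \<le> real X / real g + real (S g)"
    by metis
  \<comment> \<open>The threshold forces g S(g) <= X for every divisor g of d, so the error is no
    larger than the main term X/g.\<close>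
  have "(\<Sum>d'\<in>B X. overlap (\<theta> k) \<epsilon> d d') \<le> 2 / (real n * M) * divisor_weight d"
    if X: "X \<ge> (\<Sum>g | g dvd d. g * S g) + 1" for X
  proof -
    have X0: "X > 0" using X by simp
    have "B X \<subseteq> {X<..2 * X}"
      by (auto simp: B_def Bohr_def)
    from sum_overlap_le[OF d this]
    have "(\<Sum>d'\<in>B X. overlap (\<theta> k) \<epsilon> d d')
      \<le> (\<Sum>g | g dvd d. real g / (real d * real X) * real (card (close_quotients (\<theta> k) \<epsilon> d X (B X) g)))" .
    also have "\<dots> \<le> (\<Sum>g | g dvd d. 2 / (real n * M * real d) * (1 / real g))"
    proof (rule sum_mono)
      fix g assume g: "g \<in> {g. g dvd d}"
      then have g0: "g > 0" using d by (auto intro: dvd_pos_nat)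
      have "g * S g \<le> (\<Sum>g | g dvd d. g * S g)"
        using d g by (intro member_le_sum) auto
      then have "real (g * S g) \<le> real X"
        using X by (simp only: of_nat_le_iff)
      then have "real X / real g + real (S g) \<le> 2 * real X / real g"
        using g0 by (simp add: field_simps)
      then have "real (card (close_quotients (\<theta> k) \<epsilon> d X (B X) g)) * (M * (real n * real g)) \<le> 2 * real X / real g"
        using S[OF g0, of X] by linarith
      then have "real (card (close_quotients (\<theta> k) \<epsilon> d X (B X) g)) \<le> (2 * real X / real g) / (M * (real n * real g))"
        using M n g0 by (subst pos_le_divide_eq) auto
      then have "real g / (real d * real X) * real (card (close_quotients (\<theta> k) \<epsilon> d X (B X) g))
        \<le> real g / (real d * real X) * ((2 * real X / real g) / (M * (real n * real g)))"
        by (intro mult_left_mono) auto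
      also have "\<dots> = 2 / (real n * M * real d) * (1 / real g)"
        using X0 g0 by simp
      finally show "real g / (real d * real X) * real (card (close_quotients (\<theta> k) \<epsilon> d X (B X) g))
        \<le> 2 / (real n * M * real d) * (1 / real g)" .
    qed
    also have "\<dots> = 2 / (real n * M) * divisor_weight d"
      unfolding sum_distrib_left[symmetric] divisor_weight_def by simp
    finally show ?thesis .
  qed
  then show ?thesis
    unfolding eventually_sequentially B_def M_def \<epsilon>_def by blast
qed

lemma free_mod_1_irrational:
  assumes "free_mod_1 J \<theta>" and "j \<in> J"
  shows "\<theta> j \<notin> \<rat>"
proof
  assume "\<theta> j \<in> \<rat>"
  then obtain a b :: int where ab: "b > 0" "\<theta> j = of_int a / of_int b"
    by (meson Rats_cases')
  have fin: "finite J" using assms free_mod_1_finite by blast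
  define n where "n i = (if i = j then b else 0)" for i
  have "(\<Sum>i\<in>J. of_int (n i) * \<theta> i) = (\<Sum>i\<in>{j}. of_int (n i) * \<theta> i)"
    using fin assms(2) by (intro sum.mono_neutral_right) (auto simp: n_def)
  also have "\<dots> = of_int a"
    using ab by (simp add: n_def)
  finally have "(\<Sum>i\<in>J. of_int (n i) * \<theta> i) \<in> \<int>"
    by simp
  then have "\<forall>i\<in>J. n i = 0"
    using assms(1) unfolding free_mod_1_def by metis
  then show False
    using assms(2) ab by (auto simp: n_def)
qed

text \<open>The sets are built from blocks of Bohr sets in \<open>{h\<^sup>2<..2 * h\<^sup>2}\<close>, where multiples of \<open>z\<close> are
  well spaced up to \<open>h\<close>. The overlaps inside one block are merely bounded, those between different
  blocks have the size predicted by independence, so many blocks make the former negligible.\<close>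

lemma exists_Bohr_set_with_blocks:
  assumes free: "free_mod_1 (insert k J) \<theta>" and k: "k \<notin> J"
    and m: "m > (0::nat)" and n: "n > (0::nat)"
  shows "\<exists>D. finite D \<and> 0 \<notin> D \<and> (\<forall>d\<in>D. \<forall>j\<in>J. dist_int (real d * \<theta> j) < 1 / (4 * real m)) \<and>
    (\<Sum>d\<in>D. divisor_weight d) \<le> real L * (4 / real m ^ card J) \<and>
    (\<Sum>d\<in>D. 1 / real d) \<ge> real L / (4 * (16 * real m) ^ card J) \<and>
    (\<Sum>d\<in>D. \<Sum>d'\<in>D. overlap (\<theta> k) (1 / (8 * real n)) d d')
      \<le> 249 * real L + 8 * (real L)\<^sup>2 / (real n * (real m ^ card J)\<^sup>2)"
proof (induction L)
  case 0
  show ?case by (intro exI[of _ "{}"]) simp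
next
  case (Suc L)
  define \<epsilon> where "\<epsilon> = 1 / (8 * real n)"
  have \<epsilon>: "0 < \<epsilon>" "\<epsilon> \<le> 1 / 8"
    using n by (simp_all add: \<epsilon>_def)
  define M where "M = real m ^ card J"
  have M: "M > 0" using m by (simp add: M_def)
  define T where "T A B = (\<Sum>d\<in>A. \<Sum>d'\<in>B. overlap (\<theta> k) \<epsilon> d d')" for A B
  obtain D where D: "finite D" "0 \<notin> D" "\<forall>d\<in>D. \<forall>j\<in>J. dist_int (real d * \<theta> j) < 1 / (4 * real m)"
    and w: "(\<Sum>d\<in>D. divisor_weight d) \<le> real L * (4 / M)"
    and s: "(\<Sum>d\<in>D. 1 / real d) \<ge> real L / (4 * (16 * real m) ^ card J)"
    and t: "T D D \<le> 249 * real L + 8 * (real L)\<^sup>2 / (real n * M\<^sup>2)"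
    using Suc unfolding M_def T_def \<epsilon>_def by metis
  have freeJ: "free_mod_1 J \<theta>"
    using free_mod_1_subset[OF free] by blast
  define B where "B = Bohr J \<theta> (1 / (4 * real m))"
  obtain S where S: "\<And>X. X \<le> (16 * m) ^ card J * card (B X) + S"
    using card_Bohr_ge[OF freeJ m] unfolding B_def by metis
  have "\<forall>\<^sub>F X in sequentially. (\<forall>d\<in>D. (\<Sum>d'\<in>B X. overlap (\<theta> k) \<epsilon> d d') \<le> 2 / (real n * M) * divisor_weight d)
      \<and> (\<Sum>d\<in>B X. divisor_weight d) \<le> 4 / M \<and> X \<ge> 2 * S \<and> X > Max (insert 0 D)"
  proof (intro eventually_conj)
    show "\<forall>\<^sub>F X in sequentially. \<forall>d\<in>D. (\<Sum>d'\<in>B X. overlap (\<theta> k) \<epsilon> d d') \<le> 2 / (real n * M) * divisor_weight d"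
      unfolding B_def \<epsilon>_def M_def using D
      by (intro eventually_ball_finite ballI sum_overlap_Bohr_le[OF free k m n]) (auto intro: gr0I)
    show "\<forall>\<^sub>F X in sequentially. (\<Sum>d\<in>B X. divisor_weight d) \<le> 4 / M"
      unfolding B_def M_def by (rule sum_divisor_weight_Bohr_le[OF freeJ m])
  qed (rule eventually_ge_at_top eventually_gt_at_top)+
  then obtain X0 where X0: "\<And>X. X \<ge> X0 \<Longrightarrow> (\<forall>d\<in>D. (\<Sum>d'\<in>B X. overlap (\<theta> k) \<epsilon> d d') \<le> 2 / (real n * M) * divisor_weight d)
      \<and> (\<Sum>d\<in>B X. divisor_weight d) \<le> 4 / M \<and> X \<ge> 2 * S \<and> X > Max (insert 0 D)"
    unfolding eventually_sequentially by blast
  have "\<theta> k \<notin> \<rat>"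
    using free_mod_1_irrational[OF free] by blast
  \<comment> \<open>All requirements on X hold eventually, so X may be taken from the sparse set of
    squares of well-spaced lengths h beyond the threshold; note X >= h.\<close>
  then obtain h where h: "h > X0" "\<And>i. 0 < i \<Longrightarrow> i \<le> h \<Longrightarrow> 1 / (8 * real h) \<le> dist_int (real i * \<theta> k)"
    using exists_well_spaced_multiples by meson
  define X where "X = h\<^sup>2"
  have "h \<le> X"
    by (simp add: X_def power2_eq_square)
  then have cross: "\<And>d. d \<in> D \<Longrightarrow> (\<Sum>d'\<in>B X. overlap (\<theta> k) \<epsilon> d d') \<le> 2 / (real n * M) * divisor_weight d"
    and wB: "(\<Sum>d\<in>B X. divisor_weight d) \<le> 4 / M" and XS: "X \<ge> 2 * S" and Xm: "X > Max (insert 0 D)"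
    using X0[of X] h(1) by auto
  have sub: "B X \<subseteq> {X<..2 * X}"
    by (auto simp: B_def Bohr_def)
  have X: "X > 0" using h(1) by (simp add: X_def)
  have finB: "finite (B X)"
    by (simp add: B_def finite_Bohr)
  have disj: "D \<inter> B X = {}"
  proof -
    have "d < X" if "d \<in> D" for d
      using Xm D(1) that by auto
    then show ?thesis using sub by fastforce
  qed
  have "(\<Sum>d\<in>D \<union> B X. divisor_weight d) \<le> real (Suc L) * (4 / M)"
    using w wB D(1) finB disj by (simp add: sum.union_disjoint algebra_simps add_divide_distrib)
  moreover have "(\<Sum>d\<in>D \<union> B X. 1 / real d) \<ge> real (Suc L) / (4 * (16 * real m) ^ card J)"
  proof -
    \<comment> \<open>The 4 is made of two factors 2: half of X is lost to the Kronecker error S,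
      and d may be as large as 2 X.\<close>
    have "real X \<le> real ((16 * m) ^ card J * card (B X) + S)"
      using S by (intro of_nat_mono)
    moreover have "real S \<le> real X / 2"
      using XS by simp
    ultimately have "real X / 2 \<le> (16 * real m) ^ card J * real (card (B X))"
      by (simp only: of_nat_add of_nat_mult of_nat_power of_nat_numeral)
    then have "1 / (4 * (16 * real m) ^ card J) \<le> real (card (B X)) / (2 * real X)"
      using X m by (simp add: field_simps)
    also have "\<dots> = (\<Sum>d\<in>B X. 1 / (2 * real X))"
      by simp
    also have "\<dots> \<le> (\<Sum>d\<in>B X. 1 / real d)"
      using sub X by (intro sum_mono divide_left_mono) force+
    finally show ?thesis
      using s D(1) finB disj by (simp add: sum.union_disjoint add_divide_distrib)
  qed
  moreover have "T (D \<union> B X) (D \<union> B X) \<le> 249 * real (Suc L) + 8 * (real (Suc L))\<^sup>2 / (real n * M\<^sup>2)"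
  proof -
    have "T D (B X) \<le> (\<Sum>d\<in>D. 2 / (real n * M) * divisor_weight d)"
      unfolding T_def using cross by (rule sum_mono)
    also have "\<dots> = 2 / (real n * M) * (\<Sum>d\<in>D. divisor_weight d)"
      by (simp only: sum_distrib_left)
    also have "\<dots> \<le> 2 / (real n * M) * (real L * (4 / M))"
      using w M by (intro mult_left_mono) auto
    also have "\<dots> = 8 * real L / (real n * M\<^sup>2)"
      by (simp add: power2_eq_square)
    finally have DB: "T D (B X) \<le> 8 * real L / (real n * M\<^sup>2)" .
    have BD: "T (B X) D = T D (B X)"
      unfolding T_def by (subst sum.swap) (simp only: overlap_commute[of _ _ _ d for d])
    have BB: "T (B X) (B X) \<le> 249"
      unfolding T_def using sum_overlap_diagonal_le[of h "\<theta> k" \<epsilon> "B X"] h \<epsilon> sub by (simp add: X_def)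
    have "T (D \<union> B X) (D \<union> B X) = T D D + T D (B X) + (T (B X) D + T (B X) (B X))"
      unfolding T_def using D(1) finB disj by (simp add: sum.union_disjoint sum.distrib)
    also have "\<dots> \<le> (249 * real L + 8 * (real L)\<^sup>2 / (real n * M\<^sup>2)) + 8 * real L / (real n * M\<^sup>2)
        + (8 * real L / (real n * M\<^sup>2) + 249)"
      using t DB BB unfolding BD by (intro add_mono)
    also have "\<dots> \<le> 249 * real (Suc L) + 8 * (real (Suc L))\<^sup>2 / (real n * M\<^sup>2)"
    proof -
      \<comment> \<open>The old main term 8 L^2 and the two cross terms 8 L fit into 8 (L +
        1)^2.\<close>
      have "8 * (real L)\<^sup>2 / (real n * M\<^sup>2) + 16 * real L / (real n * M\<^sup>2) \<le> 8 * (real (Suc L))\<^sup>2 / (real n * M\<^sup>2)"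
        unfolding add_divide_distrib[symmetric] using M
        by (intro divide_right_mono) (auto simp: power2_eq_square algebra_simps)
      then show ?thesis by simp
    qed
    finally show ?thesis .
  qed
  moreover have "0 \<notin> D \<union> B X" "finite (D \<union> B X)"
    using D sub finB by auto
  moreover have "\<forall>d\<in>D \<union> B X. \<forall>j\<in>J. dist_int (real d * \<theta> j) < 1 / (4 * real m)"
    using D(3) by (auto simp: B_def Bohr_def)
  ultimately show ?case
    unfolding T_def M_def \<epsilon>_def by (intro exI[of _ "D \<union> B X"] conjI)
qed

lemma exists_Bohr_set_small_overlap:
  assumes free: "free_mod_1 (insert k J) \<theta>" and k: "k \<notin> J"
    and m: "m > (0::nat)" and n: "n > (0::nat)"
  shows "\<exists>D. finite D \<and> 0 \<notin> D \<and> D \<noteq> {} \<and> (\<forall>d\<in>D. \<forall>j\<in>J. dist_int (real d * \<theta> j) < 1 / (4 * real m)) \<and>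
    (\<Sum>d\<in>D. \<Sum>d'\<in>D. overlap (\<theta> k) (1 / (8 * real n)) d d')
      \<le> 144 * 16 ^ (2 * card J) * (1 / real n) * (\<Sum>d\<in>D. 1 / real d)\<^sup>2"
proof -
  define M where "M = real m ^ card J"
  have M: "M > 0" using m by (simp add: M_def)
  \<comment> \<open>Makes the diagonal cost 249 L equal to L^2/(n M^2), one eighth of the main term.
    The total 9 L^2/(n M^2) then yields 144 = 9 * 4^2, where the 4 comes from the lower bound for
    the sum of 1/d.\<close>
  define L where "L = 249 * n * (m ^ card J)\<^sup>2"
  have L: "L > 0" "real L = 249 * real n * M\<^sup>2"
    using m n by (simp_all add: L_def M_def)
  obtain D where D: "finite D" "0 \<notin> D" "\<forall>d\<in>D. \<forall>j\<in>J. dist_int (real d * \<theta> j) < 1 / (4 * real m)"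
    and s: "(\<Sum>d\<in>D. 1 / real d) \<ge> real L / (4 * (16 * real m) ^ card J)"
    and t: "(\<Sum>d\<in>D. \<Sum>d'\<in>D. overlap (\<theta> k) (1 / (8 * real n)) d d') \<le> 249 * real L + 8 * (real L)\<^sup>2 / (real n * M\<^sup>2)"
    using exists_Bohr_set_with_blocks[OF free k m n] unfolding M_def by metis
  have pos: "real L / (4 * (16 * real m) ^ card J) > 0"
    using L m by simp
  then have "D \<noteq> {}"
    using s by auto
  have "249 * real L = (real L)\<^sup>2 / (real n * M\<^sup>2)"
    using L n M by (simp add: power2_eq_square)
  then have "249 * real L + 8 * (real L)\<^sup>2 / (real n * M\<^sup>2) = 9 * (real L)\<^sup>2 / (real n * M\<^sup>2)"
    by simp
  also have "\<dots> = 144 * 16 ^ (2 * card J) * (1 / real n) * (real L / (4 * (16 * real m) ^ card J))\<^sup>2"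
    using n M by (simp add: M_def power_mult_distrib power_divide power_mult[symmetric] mult.commute)
  also have "\<dots> \<le> 144 * 16 ^ (2 * card J) * (1 / real n) * (\<Sum>d\<in>D. 1 / real d)\<^sup>2"
    using s pos by (intro mult_left_mono power_mono) auto
  finally show ?thesis
    using D t \<open>D \<noteq> {}\<close> by (intro exI[of _ D]) auto
qed

section \<open>Measure estimates\<close>

text \<open>Lebesgue measure of the circle, kept on the Borel sets of the line: sets of period 1
  stand for subsets of the circle. The half-open interval is tiled exactly by the cells of a
  dilation.\<close>

definition circle :: "real measure"
  where "circle = uniform_measure lborel {0..<1}"

lemma sets_circle [simp, measurable_cong]: "sets circle = sets borel"
  and space_circle [simp]: "space circle = UNIV"
  by (simp_all add: circle_def)

lemma emeasure_circle: "A \<in> sets borel \<Longrightarrow> emeasure circle A = emeasure lborel ({0..<1} \<inter> A)"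
  by (simp add: circle_def divide_ennreal_def)

lemma measure_circle: "A \<in> sets borel \<Longrightarrow> measure circle A = measure lborel ({0..<1} \<inter> A)"
  by (simp add: circle_def)

lemma measure_circle_UNIV [simp]: "measure circle UNIV = 1"
  by (simp add: measure_circle)

interpretation circle: finite_measure circle
  by standard (simp add: emeasure_circle)

lemma measure_circle_le_1: "measure circle A \<le> 1"
  using circle.bounded_measure[of A] by simp

lemma emeasure_lborel_unit_Int_finite: "emeasure lborel ({0..<1::real} \<inter> A) \<noteq> \<infinity>"
proof -
  have "emeasure lborel ({0..<1::real} \<inter> A) \<le> emeasure lborel {0..<1::real}"
    by (intro emeasure_mono) auto
  then show ?thesis by (auto simp: top_unique)
qed

definition hit :: "nat \<Rightarrow> real \<Rightarrow> real \<Rightarrow> real set"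
  where "hit q \<delta> y = {x. dist_int (real q * x - y) < \<delta>}"

definition hit_set :: "nat set \<Rightarrow> (nat \<Rightarrow> real) \<Rightarrow> real \<Rightarrow> real set"
  where "hit_set F \<psi> y = (\<Union>q\<in>F. hit q (\<psi> q) y)"

lemma hit_borel [measurable]: "hit q \<delta> y \<in> sets borel"
proof -
  have [measurable]: "(\<lambda>x. dist_int (real q * x - y)) \<in> borel_measurable borel"
    unfolding dist_int_def by (intro borel_measurable_continuous_onI continuous_intros)
  show ?thesis
    unfolding hit_def by measurable
qed

lemma hit_set_borel [measurable]: "hit_set F \<psi> y \<in> sets borel"
  unfolding hit_set_def by (intro sets.countable_UN') auto

section \<open>Counting integers and measuring hits\<close>

lemma finite_int_interval: "finite {k::int. a < real_of_int k \<and> real_of_int k < b}"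
  proof (rule finite_subset)
  show "{k::int. a < real_of_int k \<and> real_of_int k < b} \<subseteq> {\<lfloor>a\<rfloor>..\<lceil>b\<rceil>}"
  proof
    fix k :: int assume "k \<in> {k. a < real_of_int k \<and> real_of_int k < b}"
    then show "k \<in> {\<lfloor>a\<rfloor>..\<lceil>b\<rceil>}"
      by simp linarith
  qed
qed simp

lemma card_progression_le:
  fixes K :: "int set" and s :: nat
  assumes K: "K \<subseteq> {k. a < of_int k \<and> of_int k < b}" and s: "s > 0" and ab: "a \<le> b"
    and cong: "\<And>k k'. k \<in> K \<Longrightarrow> k' \<in> K \<Longrightarrow> int s dvd k - k'"
  shows "finite K" "real (card K) \<le> (b - a) / real s + 1"
proof -
  show "finite K"
    using K finite_int_interval finite_subset by blast
  define f where "f k = \<lfloor>(real_of_int k - a) / real s\<rfloor>" for k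
  have "inj_on f K"
  proof (rule linorder_inj_onI)
    fix k k' assume k: "k < k'" "k \<in> K" "k' \<in> K"
    then have "int s \<le> k' - k"
      using cong[of k' k] zdvd_imp_le by simp
    then have "real s \<le> real_of_int k' - real_of_int k"
      by linarith
    then have "1 \<le> (real_of_int k' - real_of_int k) / real s"
      using s by simp
    then have "(real_of_int k - a) / real s + 1 \<le> (real_of_int k' - a) / real s"
      by (simp add: diff_divide_distrib)
    then show "f k \<noteq> f k'"
      unfolding f_def by linarith
  qed auto
  moreover have "f ` K \<subseteq> {0..\<lfloor>(b - a) / real s\<rfloor>}"
  proof (rule image_subsetI)
    fix k assume "k \<in> K"
    then have "a < of_int k" "of_int k < b" using K by auto
    then show "f k \<in> {0..\<lfloor>(b - a) / real s\<rfloor>}"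
      by (auto simp: f_def intro!: floor_mono divide_right_mono)
  qed
  ultimately have "card K \<le> card {0..\<lfloor>(b - a) / real s\<rfloor>}"
    by (intro card_inj_on_le) auto
  also have "\<dots> = nat (\<lfloor>(b - a) / real s\<rfloor> + 1)"
    by simp
  finally have "real (card K) \<le> real (nat (\<lfloor>(b - a) / real s\<rfloor> + 1))"
    by (rule of_nat_mono)
  moreover have "0 \<le> (b - a) / real s"
    using ab by simp
  then have "0 \<le> \<lfloor>(b - a) / real s\<rfloor>" by simp
  ultimately show "real (card K) \<le> (b - a) / real s + 1"
    by (simp add: of_nat_nat) linarith
qed

text \<open>A hit near k lies in an interval of length 2 \<delta>/Q around (y + k)/Q, so only the
  number of admissible k matters. The modulus s is 1 for a single hit; for two simultaneous hits it
  is d'/gcd(d, d') and carries the gain.\<close>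

lemma measure_circle_progression_le:
  fixes K :: "int set" and s :: nat
  assumes A: "A \<in> sets borel" and Q: "Q > 0" and \<delta>: "\<delta> \<ge> 0"
    and K: "K \<subseteq> {k. a < of_int k \<and> of_int k < b}" and s: "s > 0" and ab: "a \<le> b"
    and cong: "\<And>k k'. k \<in> K \<Longrightarrow> k' \<in> K \<Longrightarrow> int s dvd k - k'"
    and cover: "\<And>x. x \<in> A \<Longrightarrow> 0 \<le> x \<Longrightarrow> x < 1 \<Longrightarrow> \<exists>k\<in>K. \<bar>Q * x - y - of_int k\<bar> < \<delta>"
  shows "measure circle A \<le> ((b - a) / real s + 1) * (2 * \<delta> / Q)"
proof -
  have fin: "finite K" and card: "real (card K) \<le> (b - a) / real s + 1"
    using card_progression_le[OF K s ab cong] by auto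
  define I where "I k = {(y + of_int k - \<delta>) / Q<..<(y + of_int k + \<delta>) / Q}" for k :: int
  have mI: "measure lborel (I k) = 2 * \<delta> / Q" and fI: "emeasure lborel (I k) \<noteq> \<infinity>" for k
  proof -
    have le: "(y + of_int k - \<delta>) / Q \<le> (y + of_int k + \<delta>) / Q"
      using Q \<delta> by (intro divide_right_mono) auto
    then show "measure lborel (I k) = 2 * \<delta> / Q"
      unfolding I_def by (subst measure_lborel_Ioo) (simp_all flip: diff_divide_distrib)
    from le show "emeasure lborel (I k) \<noteq> \<infinity>"
      unfolding I_def by simp
  qed
  have "{0..<1} \<inter> A \<subseteq> (\<Union>k\<in>K. I k)"
  proof
    fix x assume "x \<in> {0..<1} \<inter> A"
    then obtain k where k: "k \<in> K" "\<bar>Q * x - y - of_int k\<bar> < \<delta>"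
      using cover by auto
    then have "x \<in> I k"
      using Q unfolding I_def by (auto simp: pos_divide_less_eq pos_less_divide_eq mult.commute)
    with k show "x \<in> (\<Union>k\<in>K. I k)" by blast
  qed
  moreover have "(\<Union>k\<in>K. I k) \<in> fmeasurable lborel"
    using fin fI by (intro fmeasurable.finite_UN) (auto simp: fmeasurable_def I_def less_top)
  ultimately have "measure lborel ({0..<1} \<inter> A) \<le> measure lborel (\<Union>k\<in>K. I k)"
    using A by (intro measure_mono_fmeasurable) auto
  also have "\<dots> \<le> (\<Sum>k\<in>K. measure lborel (I k))"
    using fin fI by (intro measure_UNION_le) (auto simp: fmeasurable_def I_def less_top)
  also have "\<dots> = real (card K) * (2 * \<delta> / Q)"
    by (simp add: mI)
  also have "\<dots> \<le> ((b - a) / real s + 1) * (2 * \<delta> / Q)"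
    using card Q \<delta> by (intro mult_right_mono) auto
  finally show ?thesis
    using A by (simp add: measure_circle)
qed

text \<open>The constant is 6 and not 2 because a crude window of length q + 1 for k gives (q + 2)/q
  <= 3. For \<delta> > 1/2 the bound exceeds the total mass.\<close>

lemma measure_hit_le:
  assumes q: "q > 0" and \<delta>: "\<delta> > 0"
  shows "measure circle (hit q \<delta> y) \<le> 6 * \<delta>"
proof (cases "\<delta> \<le> 1 / 2")
  case True
  define K where "K = {k::int. - y - 1 / 2 < of_int k \<and> of_int k < real q - y + 1 / 2}"
  have "measure circle (hit q \<delta> y) \<le> (((real q - y + 1 / 2) - (- y - 1 / 2)) / real 1 + 1) * (2 * \<delta> / real q)"
  proof (rule measure_circle_progression_le[where K = K and y = y])
    fix x assume x: "x \<in> hit q \<delta> y" "0 \<le> x" "x < 1"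
    then obtain k :: int where k: "\<bar>real q * x - y - of_int k\<bar> < \<delta>"
      by (auto simp: hit_def dist_int_less_iff)
    moreover have "0 \<le> real q * x" "real q * x \<le> real q"
      using x by (auto simp: mult_left_le)
    ultimately have "- y - 1 / 2 < of_int k" "of_int k < real q - y + 1 / 2"
      using True unfolding abs_less_iff by linarith+
    with k show "\<exists>k\<in>K. \<bar>real q * x - y - of_int k\<bar> < \<delta>"
      unfolding K_def by blast
  qed (use q \<delta> in \<open>auto simp: K_def\<close>)
  also have "\<dots> = 2 * \<delta> * ((real q + 2) / real q)"
    by simp
  also have "\<dots> \<le> 2 * \<delta> * 3"
    using q \<delta> by (intro mult_left_mono) (auto simp: pos_divide_le_eq)
  finally show ?thesis by simp
next
  case False
  then show ?thesis
    using measure_circle_le_1[of "hit q \<delta> y"] by linarith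
qed

text \<open>Eliminate x: for hits near k and k', multiplying by d and d' and subtracting puts the
  integer d k - d' k' within 2 \<epsilon> of (d' - d) z. As 4 \<epsilon> < 1, this integer is the
  same for all common hits, so k stays in one residue class modulo d'/g. Division by g gives the
  closeness condition, so a pair that violates it has no common hit.\<close>

lemma measure_hit_Int_le:
  assumes P: "P > 0" and d: "d dvd P" "d' dvd P" and \<epsilon>: "0 < \<epsilon>" "\<epsilon> \<le> 1 / 8"
  shows "measure circle (hit (P div d) (\<epsilon> / real d) z \<inter> hit (P div d') (\<epsilon> / real d') z) \<le> 6 * \<epsilon> * overlap z \<epsilon> d d'"
proof -
  have dpos: "d > 0" "d' > 0"
    using P d by (auto intro: gr0I)
  define g where "g = gcd d d'"
  have g: "g > 0" using dpos by (simp add: g_def)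
  define s where "s = d' div g"
  have s: "s > 0" "real s = real d' / real g"
    using g dpos by (auto simp: s_def g_def real_of_nat_div div_greater_zero_iff intro!: gcd_le2_nat)
  define Q where "Q = real (P div d)"
  define Q' where "Q' = real (P div d')"
  have Q: "Q = real P / real d" "Q' = real P / real d'" "Q > 0"
    using d P dpos by (auto simp: Q_def Q'_def real_of_nat_div)
  define A where "A = hit (P div d) (\<epsilon> / real d) z \<inter> hit (P div d') (\<epsilon> / real d') z"
  define R where "R x k k' \<longleftrightarrow> 0 \<le> x \<and> x < 1 \<and> \<bar>Q * x - z - of_int k\<bar> < \<epsilon> / real d \<and> \<bar>Q' * x - z - of_int k'\<bar> < \<epsilon> / real d'"
    for x and k k' :: int
  have near: "\<bar>(real d' - real d) * z - of_int (int d * k - int d' * k')\<bar> < 2 * \<epsilon>" if "R x k k'" for x k k'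
  proof -
    have 1: "\<bar>real P * x - real e * z - real e * of_int j\<bar> < \<epsilon>"
      if e: "e > 0" and *: "\<bar>real P / real e * x - z - of_int j\<bar> < \<epsilon> / real e" for e and j :: int
    proof -
      have "real P * x - real e * z - real e * of_int j = real e * (real P / real e * x - z - of_int j)"
        using e by (simp add: algebra_simps)
      then have "\<bar>real P * x - real e * z - real e * of_int j\<bar> = real e * \<bar>real P / real e * x - z - of_int j\<bar>"
        by (simp add: abs_mult)
      also have "\<dots> < real e * (\<epsilon> / real e)"
        using e * by (intro mult_strict_left_mono) auto
      finally show ?thesis using e by simp
    qed
    have "\<bar>real P * x - real d * z - real d * of_int k\<bar> < \<epsilon>" "\<bar>real P * x - real d' * z - real d' * of_int k'\<bar> < \<epsilon>"
      using 1[OF dpos(1)] 1[OF dpos(2)] that by (auto simp: R_def Q)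
    then show ?thesis
      by (simp add: left_diff_distrib abs_less_iff)
  qed
  define K where "K = {k. \<exists>x k'. R x k k'}"
  \<comment> \<open>Q/s = P/lcm(d, d') is at least 1, so the summand 1 of the count can be
    absorbed.\<close>
  have bound: "((Q + 1 / 8 - z) - (- z - 1 / 8)) / real s + 1 \<le> 3 * (Q / real s)"
  proof -
    have "lcm d d' dvd P" using d by simp
    then have "real (lcm d d') \<le> real P"
      using P dvd_imp_le by simp
    moreover have "real (lcm d d') * real g = real d * real d'"
      by (simp add: g_def flip: of_nat_mult)
    ultimately have "real d * real d' \<le> real P * real g"
      by (metis mult_right_mono of_nat_0_le_iff)
    then have 1: "1 \<le> Q / real s"
      using dpos by (simp add: Q(1) s(2) pos_le_divide_eq)
    have "1 \<le> Q"
      using Q P d by (simp add: dpos dvd_imp_le)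
    then have "(Q + 1 / 8 - z - (- z - 1 / 8)) / real s \<le> 2 * Q / real s"
      by (intro divide_right_mono) auto
    with 1 show ?thesis by simp
  qed
  show ?thesis
  proof (cases "close_pair z \<epsilon> d d'")
    case True
    have "measure circle A \<le> (((Q + 1 / 8 - z) - (- z - 1 / 8)) / real s + 1) * (2 * (\<epsilon> / real d) / Q)"
    proof (rule measure_circle_progression_le[where K = K and y = z])
      show "K \<subseteq> {k. - z - 1 / 8 < of_int k \<and> of_int k < Q + 1 / 8 - z}"
      proof (rule subsetI, clarsimp simp: K_def)
        fix k x k' assume "R x k k'"
        then have "0 \<le> Q * x" "Q * x \<le> Q" and *: "\<bar>Q * x - z - of_int k\<bar> < \<epsilon> / real d"
          using Q(3) by (auto simp: R_def)
        moreover have "\<epsilon> / real d \<le> \<epsilon> / 1"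
          using dpos \<epsilon> by (intro divide_left_mono) auto
        ultimately show "- z - 1 / 8 < of_int k \<and> of_int k < Q + 1 / 8 - z"
          using \<epsilon> unfolding abs_less_iff by linarith
      qed
      show "int s dvd k1 - k2" if kk: "k1 \<in> K" "k2 \<in> K" for k1 k2
      proof -
        obtain x1 x2 k1' k2' where R: "R x1 k1 k1'" "R x2 k2 k2'"
          using kk unfolding K_def by blast
        have "\<bar>real_of_int ((int d * k1 - int d' * k1') - (int d * k2 - int d' * k2'))\<bar> < 1"
          using near[OF R(1)] near[OF R(2)] \<epsilon> by (simp only: of_int_diff)
        then have "\<bar>(int d * k1 - int d' * k1') - (int d * k2 - int d' * k2')\<bar> < 1"
          by linarith
        then have eq: "int d * (k1 - k2) = int d' * (k1' - k2')"
          by (simp add: algebra_simps)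
        define e where "e = d div g"
        have e: "d = g * e" and d's: "d' = g * s"
          by (simp_all add: e_def s_def g_def)
        have "coprime e s"
          unfolding e_def s_def g_def using dpos by (intro div_gcd_coprime) auto
        moreover have "int g * (int e * (k1 - k2)) = int g * (int s * (k1' - k2'))"
          using eq by (simp add: e d's mult.assoc)
        then have "int e * (k1 - k2) = int s * (k1' - k2')"
          using g by simp
        then have "int s dvd int e * (k1 - k2)" by simp
        ultimately show ?thesis
          by (simp add: coprime_commute coprime_dvd_mult_right_iff)
      qed
      fix x assume "x \<in> A" "0 \<le> x" "x < 1"
      then obtain k k' where "R x k k'"
        by (auto simp: A_def hit_def dist_int_less_iff R_def Q_def Q'_def)
      then show "\<exists>k\<in>K. \<bar>Q * x - z - of_int k\<bar> < \<epsilon> / real d"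
        by (auto simp: K_def R_def)
    qed (use \<epsilon> s Q in \<open>auto simp: A_def\<close>)
    also have "\<dots> \<le> 3 * (Q / real s) * (2 * (\<epsilon> / real d) / Q)"
      using bound \<epsilon> Q by (intro mult_right_mono) auto
    also have "\<dots> = 6 * \<epsilon> * overlap z \<epsilon> d d'"
      using Q(3) s(2) True g by (simp add: overlap_def g_def mult_ac)
    finally show ?thesis by (simp add: A_def)
  next
    case False
    have "\<not> R x k k'" for x k k'
    proof
      assume R: "R x k k'"
      have "(real d - real d') / real g * z - of_int ((int d' * k' - int d * k) div int g)
          = - (((real d' - real d) * z - of_int (int d * k - int d' * k')) / real g)"
      proof -
        have "int g dvd int d' * k' - int d * k" by (simp add: g_def)
        then have "of_int ((int d' * k' - int d * k) div int g) = real_of_int (int d' * k' - int d * k) / real g"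
          by (metis of_int_of_nat_eq real_of_int_div)
        then show ?thesis
          by (simp add: diff_divide_distrib left_diff_distrib add_divide_distrib)
      qed
      then have "\<bar>(real d - real d') / real g * z - of_int ((int d' * k' - int d * k) div int g)\<bar> < 2 * \<epsilon> / real g"
        using near[OF R] g by (simp add: divide_strict_right_mono)
      then show False
        using False unfolding close_pair_def dist_int_less_iff g_def by blast
    qed
    then have "{0..<1} \<inter> A = {}"
      by (auto simp: A_def hit_def dist_int_less_iff R_def Q_def Q'_def)
    then show ?thesis
      using \<epsilon> by (simp add: measure_circle overlap_nonneg flip: A_def) (simp add: A_def measure_circle overlap_nonneg)
  qed
qed

text \<open>Whatever y is, q - 1 disjoint intervals of length 2 \<delta>/q fit inside the unit
  interval, and 2 (q - 1)/q >= 1 for q >= 2.\<close>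

lemma measure_hit_ge:
  assumes q: "q \<ge> 2" and \<delta>: "0 < \<delta>" "\<delta> \<le> 1 / 2"
  shows "\<delta> \<le> measure circle (hit q \<delta> y)"
proof -
  define k1 where "k1 = \<lceil>1 / 2 - y\<rceil>"
  have k1: "1 / 2 \<le> y + of_int k1" "y + of_int k1 < 3 / 2"
    unfolding k1_def by linarith+
  define c where "c i = y + of_int k1 + real i" for i :: nat
  define I where "I i = {(c i - \<delta>) / real q<..<(c i + \<delta>) / real q}" for i :: nat
  have lt: "(c i - \<delta>) / real q < (c i + \<delta>) / real q" for i
    using q \<delta> by (intro divide_strict_right_mono) auto
  have mI: "measure lborel (I i) = 2 * \<delta> / real q" and fI: "emeasure lborel (I i) \<noteq> \<infinity>" for i
    using less_imp_le[OF lt[of i]] unfolding I_def by (simp_all flip: diff_divide_distrib)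
  have in_I: "x \<in> I i \<longleftrightarrow> \<bar>real q * x - c i\<bar> < \<delta>" for x i
    using q unfolding I_def by (auto simp: pos_divide_less_eq pos_less_divide_eq mult.commute abs_less_iff)
  have disj: "disjoint_family_on I {..<q - 1}"
    unfolding disjoint_family_on_def
  proof (intro ballI impI)
    fix i j :: nat assume "i \<noteq> j"
    then have "1 \<le> \<bar>c i - c j\<bar>"
      by (simp add: c_def)
    then show "I i \<inter> I j = {}"
      using in_I \<delta> by (auto simp: abs_less_iff)
  qed
  have sub: "(\<Union>i<q - 1. I i) \<subseteq> {0..<1} \<inter> hit q \<delta> y"
  proof (clarify, intro IntI)
    fix x i assume i: "i < q - 1" and "x \<in> I i"
    then have x: "\<bar>real q * x - c i\<bar> < \<delta>" by (simp add: in_I)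
    have "real i + 1 \<le> real q - 1"
      using i by linarith
    then have "c i + \<delta> < real q" "0 \<le> c i - \<delta>"
      using k1 \<delta> by (simp_all add: c_def)
    then have "real q * 0 < real q * x" "real q * x < real q * 1"
      using x unfolding abs_less_iff by linarith+
    then have "0 < x" "x < 1"
      using mult_left_less_imp_less of_nat_0_le_iff by blast+
    then show "x \<in> {0..<1}" by simp
    have "\<bar>(real q * x - y) - of_int (k1 + int i)\<bar> < \<delta>"
      using x by (simp add: c_def algebra_simps)
    then show "x \<in> hit q \<delta> y"
      unfolding hit_def dist_int_less_iff by blast
  qed
  have "\<delta> * 1 \<le> \<delta> * (2 * (real q - 1) / real q)"
    using q \<delta> by (intro mult_left_mono) (auto simp: field_simps)
  also have "\<dots> = (\<Sum>i<q - 1. measure lborel (I i))"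
    using q by (simp add: mI of_nat_diff)
  also have "\<dots> = measure lborel (\<Union>i<q - 1. I i)"
  proof (rule measure_finite_Union[symmetric])
    show "I ` {..<q - 1} \<subseteq> sets lborel" by (auto simp: I_def)
  qed (use fI disj in auto)
  also have "\<dots> \<le> measure lborel ({0..<1} \<inter> hit q \<delta> y)"
    using sub emeasure_lborel_unit_Int_finite[of "hit q \<delta> y"]
    by (intro measure_mono_fmeasurable) (auto simp: fmeasurable_def I_def less_top)
  finally show ?thesis
    by (simp add: measure_circle)
qed

section \<open>The second moment method and the union of the hits of z\<close>

text \<open>A form of the Chung-Erdos inequality. If f counts the sets \<open>U d\<close> containing
  a point, then 1 - (1 - l f)^2 is at most the indicator of the union for every l; integrate and
  choose l.\<close>

lemma measure_circle_UN_ge: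
  assumes fin: "finite D" and U: "\<And>d. d \<in> D \<Longrightarrow> U d \<in> sets borel" and S: "S > 0" and C: "C > 0"
    and first: "S \<le> (\<Sum>d\<in>D. measure circle (U d))"
    and second: "(\<Sum>d\<in>D. \<Sum>d'\<in>D. measure circle (U d \<inter> U d')) \<le> C * S\<^sup>2"
  shows "1 / C \<le> measure circle (\<Union>d\<in>D. U d)"
proof -
  define f :: "real \<Rightarrow> real" where "f x = (\<Sum>d\<in>D. indicator (U d) x)" for x
  \<comment> \<open>Maximises 2 l S - l^2 C S^2.\<close>
  define l where "l = 1 / (C * S)"
  have l: "l > 0" using S C by (simp add: l_def)
  have UN: "(\<Union>d\<in>D. U d) \<in> sets borel"
    using fin U by (intro sets.finite_UN) auto
  have int: "integrable circle (indicator A :: real \<Rightarrow> real)" if "A \<in> sets borel" for A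
    using that by (intro integrable_real_indicator) (auto simp: circle.emeasure_finite less_top[symmetric])
  have f2: "(f x)\<^sup>2 = (\<Sum>d\<in>D. \<Sum>d'\<in>D. indicator (U d \<inter> U d') x)" for x
    by (simp add: f_def power2_eq_square sum_product indicator_inter_arith)
  have int_f: "integrable circle f" "integral\<^sup>L circle f = (\<Sum>d\<in>D. measure circle (U d))"
    unfolding f_def using U int by (auto intro!: Bochner_Integration.integrable_sum simp: Bochner_Integration.integral_sum)
  have int_f2: "integrable circle (\<lambda>x. (f x)\<^sup>2)"
    "integral\<^sup>L circle (\<lambda>x. (f x)\<^sup>2) = (\<Sum>d\<in>D. \<Sum>d'\<in>D. measure circle (U d \<inter> U d'))"
  proof -
    have "U d \<inter> U d' \<in> sets borel" if "d \<in> D" "d' \<in> D" for d d'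
      using U that by auto
    then show "integrable circle (\<lambda>x. (f x)\<^sup>2)"
      "integral\<^sup>L circle (\<lambda>x. (f x)\<^sup>2) = (\<Sum>d\<in>D. \<Sum>d'\<in>D. measure circle (U d \<inter> U d'))"
      unfolding f2 using int
      by (auto intro!: Bochner_Integration.integrable_sum simp: Bochner_Integration.integral_sum)
  qed
  have "2 * l * S - l\<^sup>2 * (C * S\<^sup>2) \<le> 2 * l * integral\<^sup>L circle f - l\<^sup>2 * integral\<^sup>L circle (\<lambda>x. (f x)\<^sup>2)"
    unfolding int_f int_f2 using first second l by (intro diff_mono mult_left_mono) auto
  also have "\<dots> = (\<integral>x. 2 * l * f x - l\<^sup>2 * (f x)\<^sup>2 \<partial>circle)"
    using int_f(1) int_f2(1) by (subst Bochner_Integration.integral_diff) auto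
  also have "\<dots> \<le> (\<integral>x. indicator (\<Union>d\<in>D. U d) x \<partial>circle)"
  proof (rule integral_mono)
    fix x
    have "2 * l * f x - l\<^sup>2 * (f x)\<^sup>2 = 1 - (1 - l * f x)\<^sup>2"
      by (simp add: power2_eq_square algebra_simps)
    moreover have "f x = 0" if "x \<notin> (\<Union>d\<in>D. U d)"
      using that by (auto simp: f_def intro!: sum.neutral)
    ultimately show "2 * l * f x - l\<^sup>2 * (f x)\<^sup>2 \<le> indicator (\<Union>d\<in>D. U d) x"
      by (cases "x \<in> (\<Union>d\<in>D. U d)") (auto simp del: UN_iff)
  qed (use int_f int_f2 int[OF UN] in auto)
  also have "\<dots> = measure circle (\<Union>d\<in>D. U d)"
    using UN by simp
  also have "2 * l * S - l\<^sup>2 * (C * S\<^sup>2) = 1 / C"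
    using S C by (simp add: l_def power2_eq_square field_simps)
  finally show ?thesis .
qed

text \<open>The lower bound contains neither m nor n, hence neither the Bohr tolerance nor
  \<epsilon> = 1/(8 n). For q = P/d the radius q/(8 n P) is \<epsilon>/d.\<close>

lemma exists_hit_set_ge:
  assumes free: "free_mod_1 (insert k J) \<theta>" and k: "k \<notin> J"
    and m: "m > (0::nat)" and n: "n > (0::nat)"
  shows "\<exists>F P. finite F \<and> 0 \<notin> F \<and> P > 0 \<and>
    (\<forall>q\<in>F. q dvd P \<and> (\<forall>j\<in>J. dist_int (real (P div q) * \<theta> j) < 1 / (4 * real m))) \<and>
    1 / (6912 * 16 ^ (2 * card J)) \<le> measure circle (hit_set F (\<lambda>q. real q / (8 * real n * real P)) (\<theta> k))"
proof -
  define \<epsilon> where "\<epsilon> = 1 / (8 * real n)"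
  have \<epsilon>: "0 < \<epsilon>" "\<epsilon> \<le> 1 / 8"
    using n by (simp_all add: \<epsilon>_def)
  obtain D where D: "finite D" "0 \<notin> D" "D \<noteq> {}" "\<forall>d\<in>D. \<forall>j\<in>J. dist_int (real d * \<theta> j) < 1 / (4 * real m)"
    and overlap: "(\<Sum>d\<in>D. \<Sum>d'\<in>D. overlap (\<theta> k) \<epsilon> d d')
      \<le> 144 * 16 ^ (2 * card J) * (1 / real n) * (\<Sum>d\<in>D. 1 / real d)\<^sup>2"
    using exists_Bohr_set_small_overlap[OF free k m n] unfolding \<epsilon>_def by blast
  \<comment> \<open>The factor 2 ensures P div d >= 2, as \<open>measure_hit_ge\<close>
    requires.\<close>
  define P where "P = 2 * \<Prod>D"
  have P: "P > 0" using D by (auto simp: P_def intro!: prod_pos gr0I)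
  have dvd: "d dvd \<Prod>D" "d dvd P" if "d \<in> D" for d
    using D(1) that dvd_prodI[of D d id] by (simp_all add: P_def dvd_mult)
  have pos: "d > 0" if "d \<in> D" for d
    using D(2) that by (auto intro: gr0I)
  define F where "F = (\<lambda>d. P div d) ` D"
  define s where "s = (\<Sum>d\<in>D. 1 / real d)"
  have s: "s > 0"
    unfolding s_def using D pos by (intro sum_pos) auto
  define U where "U d = hit (P div d) (\<epsilon> / real d) (\<theta> k)" for d
  have "1 / (6912 * 16 ^ (2 * card J)) \<le> measure circle (\<Union>d\<in>D. U d)"
  proof (rule measure_circle_UN_ge[where S = "\<epsilon> * s"])
    show "\<epsilon> * s \<le> (\<Sum>d\<in>D. measure circle (U d))"
      unfolding s_def sum_distrib_left
    proof (rule sum_mono)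
      fix d assume d: "d \<in> D"
      have "P div d = 2 * (\<Prod>D div d)"
        using dvd(1)[OF d] by (simp add: P_def div_mult_swap)
      moreover have "\<Prod>D div d > 0"
        using dvd(1)[OF d] P pos[OF d] by (simp add: P_def div_greater_zero_iff dvd_imp_le)
      ultimately have "P div d \<ge> 2" by simp
      moreover have "\<epsilon> / real d \<le> \<epsilon> / 1"
        using \<epsilon> pos[OF d] by (intro divide_left_mono) auto
      ultimately have "\<epsilon> / real d \<le> measure circle (U d)"
        unfolding U_def using \<epsilon> pos[OF d] by (intro measure_hit_ge) auto
      then show "\<epsilon> * (1 / real d) \<le> measure circle (U d)" by simp
    qed
    have "(\<Sum>d\<in>D. \<Sum>d'\<in>D. measure circle (U d \<inter> U d')) \<le> (\<Sum>d\<in>D. \<Sum>d'\<in>D. 6 * \<epsilon> * overlap (\<theta> k) \<epsilon> d d')"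
      unfolding U_def using dvd P \<epsilon> by (intro sum_mono measure_hit_Int_le) auto
    also have "\<dots> = 6 * \<epsilon> * (\<Sum>d\<in>D. \<Sum>d'\<in>D. overlap (\<theta> k) \<epsilon> d d')"
      by (simp only: sum_distrib_left)
    also have "\<dots> \<le> 6 * \<epsilon> * (144 * 16 ^ (2 * card J) * (1 / real n) * s\<^sup>2)"
      using overlap \<epsilon> unfolding s_def by (intro mult_left_mono) auto
    \<comment> \<open>Substituting 1/n = 8 \<epsilon> makes the bound quadratic in \<epsilon>, and 6
      * 144 * 8 = 6912.\<close>
    also have "\<dots> = 6912 * 16 ^ (2 * card J) * (\<epsilon> * s)\<^sup>2"
      by (simp add: \<epsilon>_def power2_eq_square)
    finally show "(\<Sum>d\<in>D. \<Sum>d'\<in>D. measure circle (U d \<inter> U d')) \<le> 6912 * 16 ^ (2 * card J) * (\<epsilon> * s)\<^sup>2" .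
  qed (use D s \<epsilon> in \<open>auto simp: U_def\<close>)
  also have "(\<Union>d\<in>D. U d) = hit_set F (\<lambda>q. real q / (8 * real n * real P)) (\<theta> k)"
  proof -
    have "real (P div d) / (8 * real n * real P) = \<epsilon> / real d" if "d \<in> D" for d
      using dvd(2)[OF that] P pos[OF that] by (simp add: real_of_nat_div \<epsilon>_def)
    then show ?thesis
      by (simp add: hit_set_def F_def U_def)
  qed
  finally have "1 / (6912 * 16 ^ (2 * card J)) \<le> measure circle (hit_set F (\<lambda>q. real q / (8 * real n * real P)) (\<theta> k))" .
  moreover have "\<forall>q\<in>F. q dvd P \<and> (\<forall>j\<in>J. dist_int (real (P div q) * \<theta> j) < 1 / (4 * real m))"
  proof
    fix q assume "q \<in> F"
    then obtain d where d: "d \<in> D" "q = P div d" by (auto simp: F_def)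
    obtain c where c: "P = d * c"
      using dvd(2)[OF d(1)] by (auto elim: dvdE)
    then have "q = c" "P div q = d" "q dvd P"
      using d P pos[OF d(1)] by auto
    then show "q dvd P \<and> (\<forall>j\<in>J. dist_int (real (P div q) * \<theta> j) < 1 / (4 * real m))"
      using d D(4) by simp
  qed
  moreover have "0 \<notin> F"
    using dvd(2) P by (auto simp: F_def dvd_div_eq_0_iff)
  moreover have "finite F"
    using D by (simp add: F_def)
  ultimately show ?thesis
    using P by blast
qed

lemma measure_hit_set_le:
  assumes F: "\<And>q. q \<in> F \<Longrightarrow> q dvd P \<and> (\<forall>j\<in>J. dist_int (real (P div q) * \<theta> j) < \<eta>)" and P: "P > 0" and R: "R > (0::nat)"
    and mult: "\<And>d. \<forall>j\<in>J. dist_int (real d * \<theta> j) < \<eta> \<Longrightarrow> dist_int (real d * (real R * y)) \<le> K * \<eta>"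
    and K: "K \<ge> 0" "\<eta> \<ge> 0" and n: "n > (0::nat)"
  shows "measure circle (hit_set F (\<lambda>q. real q / (8 * real n * real P)) y) \<le> 6 * (real R / (8 * real n) + K * \<eta>)"
proof -
  have "hit_set F (\<lambda>q. real q / (8 * real n * real P)) y \<subseteq> hit (P * R) (real R / (8 * real n) + K * \<eta>) 0"
  proof
    fix x assume "x \<in> hit_set F (\<lambda>q. real q / (8 * real n * real P)) y"
    then obtain q where q: "q \<in> F" "dist_int (real q * x - y) < real q / (8 * real n * real P)"
      by (auto simp: hit_set_def hit_def)
    obtain d where d: "P = q * d" using F[OF q(1)] by (auto elim: dvdE)
    then have dq: "d > 0" "q > 0" "P div q = d"
      using P by auto
    have "real (P * R) * x - 0 = of_int (int (d * R)) * (real q * x - y) + real d * (real R * y)"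
      by (simp add: d algebra_simps)
    then have "dist_int (real (P * R) * x - 0)
        \<le> dist_int (of_int (int (d * R)) * (real q * x - y)) + dist_int (real d * (real R * y))"
      using dist_int_add by metis
    also have "\<dots> \<le> real (d * R) * dist_int (real q * x - y) + K * \<eta>"
      using F[OF q(1)] dist_int_mult_le[of "int (d * R)" "real q * x - y"]
      by (intro add_mono mult) (auto simp: dq)
    also have "real (d * R) * dist_int (real q * x - y) < real (d * R) * (real q / (8 * real n * real P))"
      using q(2) dq R by (intro mult_strict_left_mono) auto
    also have "real (d * R) * (real q / (8 * real n * real P)) = real R / (8 * real n)"
      using dq by (simp add: d)
    finally show "x \<in> hit (P * R) (real R / (8 * real n) + K * \<eta>) 0"
      by (simp add: hit_def)
  qed
  then have "measure circle (hit_set F (\<lambda>q. real q / (8 * real n * real P)) y)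
      \<le> measure circle (hit (P * R) (real R / (8 * real n) + K * \<eta>) 0)"
    by (intro circle.finite_measure_mono) auto
  also have "\<dots> \<le> 6 * (real R / (8 * real n) + K * \<eta>)"
    using P R K n by (intro measure_hit_le) (auto intro: add_pos_nonneg)
  finally show ?thesis .
qed

section \<open>Rational bases and clearing of denominators\<close>

text \<open>R clears the denominators of the coefficients of y, so d R y is an integer combination
  of the numbers d b and the integer d, and K collects the absolute values of its coefficients. Both
  are fixed before d and \<eta>.\<close>

lemma span_Q_multiplier:
  assumes "y \<in> span_Q (insert 1 B)"
  shows "\<exists>R::nat. \<exists>K\<ge>0. R > 0 \<and> (\<forall>d::nat. \<forall>\<eta>\<ge>0. (\<forall>b\<in>B. dist_int (real d * b) < \<eta>) \<longrightarrow> dist_int (real d * (real R * y)) \<le> K * \<eta>)"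
  using assms
proof (induction rule: rat_real.span_induct_alt)
  case base
  have "dist_int 0 = 0"
    using dist_int_le[of 0 0] dist_int_nonneg[of 0] by simp
  then show ?case
    by (intro exI[of _ 1] exI[of _ 0]) simp
next
  case (step c x y)
  then obtain R K where R: "R > (0::nat)" "K \<ge> 0"
    and K: "\<And>d \<eta>. \<eta> \<ge> 0 \<Longrightarrow> \<forall>b\<in>B. dist_int (real d * b) < \<eta> \<Longrightarrow> dist_int (real d * (real R * y)) \<le> K * \<eta>"
    by blast
  obtain a b where ab: "quotient_of c = (a, b)" by (cases "quotient_of c")
  have b: "b > 0" using ab by (rule quotient_of_denom_pos)
  have c: "of_rat c = (of_int a / of_int b :: real)"
    using quotient_of_div[OF ab] by (simp add: of_rat_divide)
  have "dist_int (real d * (real (nat b * R) * (of_rat c * x + y))) \<le> (real R * \<bar>of_int a\<bar> + of_int b * K) * \<eta>"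
    if \<eta>: "\<eta> \<ge> 0" and close: "\<forall>b\<in>B. dist_int (real d * b) < \<eta>" for d \<eta>
  proof -
    have x: "dist_int (real d * x) \<le> \<eta>"
    proof (cases "x = 1")
      case True
      then show ?thesis
        using dist_int_le[of "real d" "int d"] \<eta> by simp
    next
      case False
      then show ?thesis
        using step(1) close by (auto intro: less_imp_le)
    qed
    have "real d * (real (nat b * R) * (of_rat c * x + y)) = of_int (int R * a) * (real d * x) + of_int b * (real d * (real R * y))"
      using b by (simp add: c field_simps)
    then have "dist_int (real d * (real (nat b * R) * (of_rat c * x + y)))
        \<le> dist_int (of_int (int R * a) * (real d * x)) + dist_int (of_int b * (real d * (real R * y)))"
      using dist_int_add by metis
    also have "\<dots> \<le> \<bar>of_int (int R * a)\<bar> * dist_int (real d * x) + \<bar>of_int b\<bar> * dist_int (real d * (real R * y))"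
      by (intro add_mono dist_int_mult_le)
    also have "\<dots> \<le> \<bar>of_int (int R * a)\<bar> * \<eta> + \<bar>of_int b\<bar> * (K * \<eta>)"
      using x K[OF \<eta> close] by (intro add_mono mult_left_mono) auto
    also have "\<dots> = (real R * \<bar>of_int a\<bar> + of_int b * K) * \<eta>"
      using b by (simp add: abs_mult algebra_simps)
    finally show ?thesis .
  qed
  then show ?case
    using R b by (intro exI[of _ "nat b * R"] exI[of _ "real R * \<bar>of_int a\<bar> + of_int b * K"]) auto
qed

text \<open>A maximal independent subset of \<open>insert 1 Y\<close> containing 1 spans Y, and z
  lies outside its span, so adjoining z preserves independence. Splitting off 1 turns this into
  independence modulo the integers.\<close>

lemma exists_free_basis:
  assumes fin: "finite Y" and z: "z \<notin> span_Q (insert 1 Y)"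
  shows "\<exists>B. z \<notin> B \<and> free_mod_1 (insert z B) (\<lambda>x. x) \<and> Y \<subseteq> span_Q (insert 1 B)"
proof -
  have "\<not> rat_real.dependent {1}"
    by (subst rat_real.dependent_single) simp
  then obtain C where C: "{1} \<subseteq> C" "C \<subseteq> insert 1 Y" "\<not> rat_real.dependent C" "insert 1 Y \<subseteq> span_Q C"
    using rat_real.maximal_independent_subset_extend[of "{1}" "insert 1 Y"] by (auto simp: span_Q_def)
  define B where "B = C - {1}"
  have CB: "C = insert 1 B" using C(1) by (auto simp: B_def)
  have z': "z \<notin> span_Q C"
    using z C(2) rat_real.span_mono by (auto simp: span_Q_def)
  then have zC: "z \<notin> C"
    using rat_real.span_base by (auto simp: span_Q_def)
  have ind: "\<not> rat_real.dependent (insert z C)"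
    using z' C(3) rat_real.independent_insertI by (simp add: span_Q_def)
  have finC: "finite C" using C(2) fin by (meson finite_insert finite_subset)
  have "free_mod_1 (insert z B) (\<lambda>x. x)"
    unfolding free_mod_1_def
  proof (intro conjI allI impI)
    show "finite (insert z B)" using finC by (simp add: B_def)
    fix n :: "real \<Rightarrow> int" assume "(\<Sum>j\<in>insert z B. of_int (n j) * j) \<in> \<int>"
    then obtain a where a: "(\<Sum>j\<in>insert z B. of_int (n j) * j) = of_int a"
      by (auto elim: Ints_cases)
    \<comment> \<open>A relation with integral value a becomes a vanishing one with coefficient -a
      at 1.\<close>
    define u :: "real \<Rightarrow> rat" where "u j = (if j = 1 then - of_int a else of_int (n j))" for j
    have ins: "insert z C = insert 1 (insert z B)" and n1: "1 \<notin> insert z B"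
      using zC C(1) by (auto simp: B_def)
    have "(\<Sum>j\<in>insert z C. of_rat (u j) * j) = of_rat (u 1) * 1 + (\<Sum>j\<in>insert z B. of_rat (u j) * j)"
      unfolding ins using n1 finC by (subst sum.insert) (auto simp: B_def)
    also have "(\<Sum>j\<in>insert z B. of_rat (u j) * j) = (\<Sum>j\<in>insert z B. of_int (n j) * j)"
      using n1 by (intro sum.cong) (auto simp: u_def)
    finally have "(\<Sum>j\<in>insert z C. of_rat (u j) * j) = 0"
      by (simp add: a u_def of_rat_minus)
    then have "\<forall>j\<in>insert z C. u j = 0"
      using rat_real.independentD[OF ind] finC by blast
    then show "\<forall>j\<in>insert z B. n j = 0"
      using n1 by (auto simp: u_def CB split: if_splits)
  qed
  moreover have "z \<notin> B" using zC by (simp add: B_def)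
  ultimately show ?thesis
    using C(4) CB by blast
qed

lemma exists_hit_set_separating:
  assumes fin: "finite Y" and z: "z \<notin> span_Q (insert 1 Y)"
  shows "\<exists>\<kappa>>0. \<forall>\<eta>>0. \<exists>F \<psi>. finite F \<and> 0 \<notin> F \<and> (\<forall>q. \<psi> q \<ge> 0) \<and>
    \<kappa> \<le> measure circle (hit_set F \<psi> z) \<and> (\<forall>y\<in>Y. measure circle (hit_set F \<psi> y) \<le> \<eta>)"
proof -
  obtain B where B: "z \<notin> B" "free_mod_1 (insert z B) (\<lambda>x. x)" "Y \<subseteq> span_Q (insert 1 B)"
    using exists_free_basis[OF fin z] by blast
  have "\<exists>p :: nat \<times> real. fst p > 0 \<and> snd p \<ge> 0 \<and> (\<forall>d::nat. \<forall>\<eta>\<ge>0. (\<forall>b\<in>B. dist_int (real d * b) < \<eta>) \<longrightarrow>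
      dist_int (real d * (real (fst p) * y)) \<le> snd p * \<eta>)" if "y \<in> Y" for y
    using span_Q_multiplier[of y B] B(3) that by auto
  then obtain p :: "real \<Rightarrow> nat \<times> real" where p: "\<And>y. y \<in> Y \<Longrightarrow> fst (p y) > 0 \<and> snd (p y) \<ge> 0 \<and>
      (\<forall>d::nat. \<forall>\<eta>\<ge>0. (\<forall>b\<in>B. dist_int (real d * b) < \<eta>) \<longrightarrow> dist_int (real d * (real (fst (p y)) * y)) \<le> snd (p y) * \<eta>)"
    by metis
  define R where "R y = fst (p y)" for y
  define K where "K y = snd (p y)" for y
  have RK: "\<And>y. y \<in> Y \<Longrightarrow> R y > 0" "\<And>y. y \<in> Y \<Longrightarrow> K y \<ge> 0"
    and mult: "\<And>y d \<eta>. y \<in> Y \<Longrightarrow> \<eta> \<ge> 0 \<Longrightarrow> \<forall>b\<in>B. dist_int (real d * b) < \<eta> \<Longrightarrow> dist_int (real d * (real (R y) * y)) \<le> K y * \<eta>"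
    using p by (auto simp: R_def K_def)
  show ?thesis
  proof (intro exI[of _ "1 / (6912 * 16 ^ (2 * card B))"] conjI allI impI)
    fix \<eta> :: real assume \<eta>: "\<eta> > 0"
    \<comment> \<open>One n has to serve the whole finite set, so T dominates the constants of all
      y. The same n sets the Bohr tolerance and \<epsilon>.\<close>
    define T where "T = (\<Sum>y\<in>Y. 6 * (real (R y) + K y))"
    obtain n :: nat where n: "n > 0" "T / \<eta> < real n"
      using reals_Archimedean2[of "max 0 (T / \<eta>)"] by auto
    obtain F P where F: "finite F" "0 \<notin> F" "P > 0"
      "\<And>q. q \<in> F \<Longrightarrow> q dvd P \<and> (\<forall>j\<in>B. dist_int (real (P div q) * j) < 1 / (4 * real n))"
      "1 / (6912 * 16 ^ (2 * card B)) \<le> measure circle (hit_set F (\<lambda>q. real q / (8 * real n * real P)) z)"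
      using exists_hit_set_ge[OF B(2,1) n(1) n(1)] by blast
    have "measure circle (hit_set F (\<lambda>q. real q / (8 * real n * real P)) y) \<le> \<eta>" if y: "y \<in> Y" for y
    proof -
      have "measure circle (hit_set F (\<lambda>q. real q / (8 * real n * real P)) y) \<le> 6 * (real (R y) / (8 * real n) + K y * (1 / (4 * real n)))"
        using F RK y n mult[OF y, of "1 / (4 * real n)"] by (intro measure_hit_set_le[where J = B and \<theta> = "\<lambda>x. x"]) auto
      also have "\<dots> \<le> 6 * (real (R y) / real n + K y * (1 / real n))"
        using RK(2)[OF y] n by (intro mult_left_mono add_mono divide_left_mono) auto
      also have "\<dots> = 6 * (real (R y) + K y) / real n"
        by (simp add: add_divide_distrib)
      also have "\<dots> \<le> T / real n"
        unfolding T_def using fin y RK by (intro divide_right_mono member_le_sum) auto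
      also have "\<dots> \<le> \<eta>"
        using n \<eta> by (simp add: field_simps)
      finally show ?thesis .
    qed
    then show "\<exists>F \<psi>. finite F \<and> 0 \<notin> F \<and> (\<forall>q. \<psi> q \<ge> 0) \<and>
      1 / (6912 * 16 ^ (2 * card B)) \<le> measure circle (hit_set F \<psi> z) \<and> (\<forall>y\<in>Y. measure circle (hit_set F \<psi> y) \<le> \<eta>)"
      using F by (intro exI[of _ F] exI[of _ "\<lambda>q. real q / (8 * real n * real P)"]) auto
  qed simp
qed

section \<open>Mixing under dilation\<close>

definition periodic :: "real set \<Rightarrow> bool"
  where "periodic V \<longleftrightarrow> (\<forall>x. x + 1 \<in> V \<longleftrightarrow> x \<in> V)"

lemma periodic_diff_nat:
  assumes "periodic V"
  shows "x - real i \<in> V \<longleftrightarrow> x \<in> V"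
proof (induction i)
  case (Suc i)
  have "x - real (Suc i) \<in> V \<longleftrightarrow> (x - real (Suc i)) + 1 \<in> V"
    using assms unfolding periodic_def by blast
  then show ?case
    using Suc by (simp add: algebra_simps)
qed simp

definition dilation :: "nat \<Rightarrow> real set \<Rightarrow> real set"
  where "dilation M V = (\<lambda>x. real M * x) -` V"

lemma dilation_borel [measurable]:
  assumes "V \<in> sets borel"
  shows "dilation M V \<in> sets borel"
proof -
  have "(\<lambda>x. real M * x) \<in> borel \<rightarrow>\<^sub>M borel" by simp
  from measurable_sets[OF this assms] show ?thesis
    by (simp add: dilation_def)
qed

lemma fmeasurable_bounded_borel:
  assumes "A \<in> sets borel" and "A \<subseteq> {a..<b::real}"
  shows "A \<in> fmeasurable lborel"
proof -
  have "emeasure lborel A \<le> emeasure lborel {a..b}"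
    using assms by (intro emeasure_mono) auto
  also have "\<dots> < \<infinity>"
    using emeasure_lborel_cbox_finite[of a b] by simp
  finally show ?thesis
    using assms by (simp add: fmeasurable_def)
qed

text \<open>On every cell of length 1/M the dilate is one period of V scaled by 1/M; an affine
  change of variables maps the cell to the unit interval.\<close>

lemma measure_dilation_cell:
  assumes V: "V \<in> sets borel" "periodic V" and M: "M > 0"
  shows "measure lborel ({real i / real M..<real (Suc i) / real M} \<inter> dilation M V) = measure circle V / real M"
proof -
  define T where "T x = - real i + real M * x" for x
  have T [measurable]: "T \<in> borel \<rightarrow>\<^sub>M borel"
    unfolding T_def by simp
  have A: "{0..<1} \<inter> V \<in> sets borel" using V by simp
  have pre: "T -` ({0..<1} \<inter> V) = {real i / real M..<real (Suc i) / real M} \<inter> dilation M V"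
    using M periodic_diff_nat[OF V(2), of "real M * _" i]
    by (auto simp: T_def dilation_def pos_divide_le_eq pos_less_divide_eq mult.commute)
  have "emeasure lborel ({0..<1} \<inter> V) = emeasure (density (distr lborel borel T) (\<lambda>_. ennreal \<bar>real M\<bar>)) ({0..<1} \<inter> V)"
    using lborel_real_affine[of "real M" "- real i"] M unfolding T_def by simp
  also have "\<dots> = ennreal (real M) * emeasure (distr lborel borel T) ({0..<1} \<inter> V)"
    using A by (subst emeasure_density_const) auto
  also have "emeasure (distr lborel borel T) ({0..<1} \<inter> V) = emeasure lborel (T -` ({0..<1} \<inter> V))"
    using A by (subst emeasure_distr) auto
  finally have "measure circle V = real M * measure lborel (T -` ({0..<1} \<inter> V))"
    using V by (simp add: measure_circle) (simp add: measure_def enn2real_mult)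
  then show ?thesis
    using M by (simp add: pre del: vimage_Int)
qed

lemma measure_dilation_cells:
  assumes V: "V \<in> sets borel" "periodic V" and M: "M > 0"
  shows "measure lborel ({0..<real N / real M} \<inter> dilation M V) = real N * (measure circle V / real M)"
proof (induction N)
  case (Suc N)
  let ?A = "{0..<real N / real M} \<inter> dilation M V"
  let ?B = "{real N / real M..<real (Suc N) / real M} \<inter> dilation M V"
  have "0 \<le> real N / real M" "real N / real M \<le> real (Suc N) / real M"
    by (auto intro!: divide_right_mono)
  then have "{0..<real (Suc N) / real M} \<inter> dilation M V = ?A \<union> ?B"
    using ivl_disj_un_two(3)[of 0 "real N / real M" "real (Suc N) / real M"] by blast
  moreover have "measure lborel (?A \<union> ?B) = measure lborel ?A + measure lborel ?B"
    using V fmeasurable_bounded_borel[of ?A] fmeasurable_bounded_borel[of ?B]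
    by (intro measure_Un2[THEN trans]) (auto simp: Int_Diff intro!: arg_cong[where f = "measure lborel"])
  ultimately show ?case
    using Suc measure_dilation_cell[OF V M, of N] by (simp add: algebra_simps add_divide_distrib)
qed simp

lemma measure_circle_dilation:
  assumes "V \<in> sets borel" "periodic V" and "M > 0"
  shows "measure circle (dilation M V) = measure circle V"
  using measure_dilation_cells[OF assms, of M] assms by (simp add: measure_circle)

text \<open>Dynkin induction over half-lines. For a half-line the dilate is measured cell by cell,
  with an error of at most one cell. Complements use that dilation preserves measure. For countable
  disjoint unions the limit passes through the sum, dominated by the measures of the pieces.\<close>

lemma circle_mixing:
  assumes V: "V \<in> sets borel" "periodic V" and A: "A \<in> sets borel"
  shows "(\<lambda>M. measure circle (A \<inter> dilation M V)) \<longlonglongrightarrow> measure circle A * measure circle V"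
proof -
  define v where "v = measure circle V"
  have v: "v \<ge> 0" by (simp add: v_def)
  have dil [measurable]: "dilation M V \<in> sets borel" for M
    using V by simp
  have "Int_stable (range lessThan :: real set set)"
  proof (rule Int_stableI)
    fix a b :: "real set" assume "a \<in> range lessThan" "b \<in> range lessThan"
    then obtain r s where "a = {..<r}" "b = {..<s}" by auto
    then have "a \<inter> b = {..<min r s}" by auto
    then show "a \<inter> b \<in> range lessThan" by blast
  qed
  moreover have "range lessThan \<subseteq> Pow (UNIV :: real set)" by simp
  moreover have "A \<in> sigma_sets UNIV (range lessThan)"
    using A by (simp add: borel_Iio)
  ultimately have "(\<lambda>M. measure circle (A \<inter> dilation M V)) \<longlonglongrightarrow> measure circle A * v"
  proof (induction rule: sigma_sets_induct_disjoint)
    case (basic A)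
    then obtain a where a: "A = {..<a}" by auto
    define c where "c = min 1 (max 0 a)"
    have Ac: "{0..<1} \<inter> A = {0..<c}" and c: "0 \<le> c" "c \<le> 1"
      by (auto simp: a c_def)
    have mA: "measure circle A = c"
      using c by (simp add: a measure_circle flip: Ac) (simp add: Ac[unfolded a] c)
    have bounds: "(c - 1 / real M) * v \<le> measure circle (A \<inter> dilation M V) \<and>
        measure circle (A \<inter> dilation M V) \<le> (c + 1 / real M) * v" if M: "M > 0" for M
    proof -
      define N where "N = nat \<lfloor>c * real M\<rfloor>"
      have "0 \<le> c * real M" using c by simp
      then have N: "real N \<le> c * real M" "c * real M < real N + 1"
        unfolding N_def by linarith+
      have m: "measure circle (A \<inter> dilation M V) = measure lborel ({0..<c} \<inter> dilation M V)"
        using dil by (simp add: a measure_circle Ac[unfolded a] Int_assoc[symmetric])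
      have "real N / real M \<le> c" "c \<le> real (Suc N) / real M"
        using N M by (simp_all add: pos_divide_le_eq pos_le_divide_eq)
      then have "measure lborel ({0..<real N / real M} \<inter> dilation M V) \<le> measure lborel ({0..<c} \<inter> dilation M V)"
        "measure lborel ({0..<c} \<inter> dilation M V) \<le> measure lborel ({0..<real (Suc N) / real M} \<inter> dilation M V)"
        using fmeasurable_bounded_borel[of "{0..<c} \<inter> dilation M V" 0 c]
          fmeasurable_bounded_borel[of "{0..<real (Suc N) / real M} \<inter> dilation M V" 0 "real (Suc N) / real M"]
        by (auto intro!: measure_mono_fmeasurable)
      then have 1: "real N * (v / real M) \<le> measure circle (A \<inter> dilation M V)"
        and 2: "measure circle (A \<inter> dilation M V) \<le> real (Suc N) * (v / real M)"
        unfolding m measure_dilation_cells[OF V M] v_def by auto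
      have "(c - 1 / real M) * v = (c * real M - 1) * (v / real M)"
        using M by (simp add: field_simps)
      also have "\<dots> \<le> real N * (v / real M)"
        using N v by (intro mult_right_mono) auto
      finally have "(c - 1 / real M) * v \<le> measure circle (A \<inter> dilation M V)"
        using 1 by simp
      moreover have "real (Suc N) * (v / real M) \<le> (c * real M + 1) * (v / real M)"
        using N v by (intro mult_right_mono) auto
      then have "measure circle (A \<inter> dilation M V) \<le> (c * real M + 1) * (v / real M)"
        using 2 by simp
      moreover have "(c * real M + 1) * (v / real M) = (c + 1 / real M) * v"
        using M by (simp add: field_simps)
      ultimately show ?thesis by simp
    qed
    have "(\<lambda>M. (c - 1 / real M) * v) \<longlonglongrightarrow> (c - 0) * v" "(\<lambda>M. (c + 1 / real M) * v) \<longlonglongrightarrow> (c + 0) * v"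
      by (intro tendsto_intros lim_1_over_n)+
    moreover have "\<forall>\<^sub>F M in sequentially. (c - 1 / real M) * v \<le> measure circle (A \<inter> dilation M V)"
      "\<forall>\<^sub>F M in sequentially. measure circle (A \<inter> dilation M V) \<le> (c + 1 / real M) * v"
      by (rule eventually_mono[OF eventually_gt_at_top[of 0]], use bounds in blast)+
    ultimately show ?case
      unfolding mA diff_0_right add_0_right by (rule tendsto_sandwich[rotated 2])
  next
    case empty
    show ?case by simp
  next
    case (compl A)
    then have A: "A \<in> sets borel" by (simp add: borel_Iio)
    have "\<forall>\<^sub>F M in sequentially. measure circle ((UNIV - A) \<inter> dilation M V) = v - measure circle (A \<inter> dilation M V)"
      using eventually_gt_at_top[of 0]
    proof eventually_elim
      case (elim M)
      have "(UNIV - A) \<inter> dilation M V = dilation M V - (A \<inter> dilation M V)" by auto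
      then show ?case
        using A measure_circle_dilation[OF V elim]
        by (simp add: v_def circle.finite_measure_Diff)
    qed
    moreover have "(\<lambda>M. v - measure circle (A \<inter> dilation M V)) \<longlonglongrightarrow> v - measure circle A * v"
      using compl by (intro tendsto_intros)
    moreover have "v - measure circle A * v = measure circle (UNIV - A) * v"
      using A circle.finite_measure_compl[of A] by (simp add: left_diff_distrib)
    ultimately show ?case
      by (simp add: tendsto_cong)
  next
    case (union A)
    then have A: "\<And>i. A i \<in> sets borel" by (auto simp: borel_Iio)
    have sum1: "(\<lambda>i. measure circle (A i)) sums measure circle (\<Union>i. A i)"
      using A union.hyps(1) by (intro circle.finite_measure_UNION) auto
    have sum2: "(\<lambda>i. measure circle (A i \<inter> dilation M V)) sums measure circle ((\<Union>i. A i) \<inter> dilation M V)" for M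
    proof -
      have "(\<lambda>i. measure circle (A i \<inter> dilation M V)) sums measure circle (\<Union>i. A i \<inter> dilation M V)"
        using A union.hyps(1) by (intro circle.finite_measure_UNION) (auto simp: disjoint_family_on_def)
      then show ?thesis by simp
    qed
    have "(\<lambda>M. \<Sum>i. measure circle (A i \<inter> dilation M V)) \<longlonglongrightarrow> (\<Sum>i. measure circle (A i) * v)"
    proof (rule tannerys_theorem[where M = "\<lambda>i. measure circle (A i)", THEN conjunct2, THEN conjunct2])
      show "\<forall>\<^sub>F (i, M) in at_top \<times>\<^sub>F sequentially. norm (measure circle (A i \<inter> dilation M V)) \<le> measure circle (A i)"
        using A by (intro always_eventually) (auto intro!: circle.finite_measure_mono)
    qed (use union sums_summable[OF sum1] in auto)
    moreover have "(\<Sum>i. measure circle (A i) * v) = measure circle (\<Union>i. A i) * v"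
      using sums_mult2[OF sum1] by (simp add: sums_iff)
    moreover have "(\<Sum>i. measure circle (A i \<inter> dilation M V)) = measure circle ((\<Union>i. A i) \<inter> dilation M V)" for M
      using sum2 by (simp add: sums_iff)
    ultimately show ?case by simp
  qed
  then show ?thesis by (simp add: v_def)
qed

lemma periodic_hit_set: "periodic (hit_set F \<psi> y)"
proof -
  have "dist_int (real q * (x + 1) - y) = dist_int (real q * x - y)" for q x
    using dist_int_add_int[of "real q * x - y" "int q"] by (simp add: algebra_simps)
  then show ?thesis
    by (simp add: periodic_def hit_set_def hit_def)
qed

lemma hit_set_dilation:
  assumes "M > 0"
  shows "hit_set ((*) M ` F) (\<lambda>q. \<psi> (q div M)) y = dilation M (hit_set F \<psi> y)"
  using assms by (auto simp: hit_set_def hit_def dilation_def mult_ac)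

text \<open>Replacing \<open>\<psi>\<close> by a dilate adds a set that is nearly independent of the set hit so far, so each
  step shrinks the complement by a fixed factor.\<close>

lemma boost_hit_set:
  assumes \<kappa>: "\<kappa> > 0"
    and base: "\<And>\<eta>. \<eta> > 0 \<Longrightarrow> \<exists>F \<psi>. finite F \<and> 0 \<notin> F \<and> (\<forall>q. \<psi> q \<ge> 0) \<and>
      \<kappa> \<le> measure circle (hit_set F \<psi> z) \<and> (\<forall>y\<in>Y. measure circle (hit_set F \<psi> y) \<le> \<eta>)"
    and \<eta>: "\<eta> > 0"
  shows "\<exists>F \<psi>. finite F \<and> (\<forall>q\<in>F. q > N) \<and> (\<forall>q. \<psi> q \<ge> 0) \<and>
    1 - \<eta> \<le> measure circle (hit_set F \<psi> z) \<and> (\<forall>y\<in>Y. measure circle (hit_set F \<psi> y) \<le> \<eta>)"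
proof -
  have step: "\<exists>F \<psi>. finite F \<and> (\<forall>q\<in>F. q > N) \<and> (\<forall>q. \<psi> q \<ge> 0) \<and>
    1 - (1 - \<kappa> / 2) ^ t \<le> measure circle (hit_set F \<psi> z) \<and> (\<forall>y\<in>Y. measure circle (hit_set F \<psi> y) \<le> real t * \<delta>)"
    if \<delta>: "\<delta> > 0" for t \<delta>
  proof (induction t)
    case 0
    show ?case
      by (intro exI[of _ "{}"] exI[of _ "\<lambda>_. 0"]) (simp add: hit_set_def)
  next
    case (Suc t)
    then obtain F \<psi> where F: "finite F" "\<forall>q\<in>F. q > N" "\<forall>q. \<psi> q \<ge> 0"
      "1 - (1 - \<kappa> / 2) ^ t \<le> measure circle (hit_set F \<psi> z)" "\<forall>y\<in>Y. measure circle (hit_set F \<psi> y) \<le> real t * \<delta>"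
      by blast
    obtain G \<phi> where G: "finite G" "0 \<notin> G" "\<forall>q. \<phi> q \<ge> 0"
      "\<kappa> \<le> measure circle (hit_set G \<phi> z)" "\<forall>y\<in>Y. measure circle (hit_set G \<phi> y) \<le> \<delta>"
      using base[OF \<delta>] by blast
    define A where "A = UNIV - hit_set F \<psi> z"
    have A: "A \<in> sets borel" by (simp add: A_def)
    define V where "V = hit_set G \<phi> z"
    have V: "V \<in> sets borel" "periodic V"
      by (simp_all add: V_def periodic_hit_set)
    have mA: "measure circle A \<le> (1 - \<kappa> / 2) ^ t"
      using F(4) circle.finite_measure_compl[of "hit_set F \<psi> z"] by (simp add: A_def)
    \<comment> \<open>Mixing yields the product of the measures only in the limit, so \<kappa> is
      weakened to \<kappa>/2; the inequality is then strict when A has positive measure.\<close>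
    have "\<forall>\<^sub>F M in sequentially. measure circle A * (\<kappa> / 2) \<le> measure circle (A \<inter> dilation M V)"
    proof (cases "measure circle A = 0")
      case False
      then have "measure circle A * (\<kappa> / 2) < measure circle A * measure circle V"
        using G(4) \<kappa> by (intro mult_strict_left_mono) (auto simp: V_def less_le)
      then show ?thesis
        by (rule eventually_mono[OF order_tendstoD(1)[OF circle_mixing[OF V A]]]) simp
    qed simp
    \<comment> \<open>With M beyond all of F, the dilated indices M q avoid F and no index receives
      two values; M > N keeps them above N.\<close>
    then have "\<forall>\<^sub>F M in sequentially. measure circle A * (\<kappa> / 2) \<le> measure circle (A \<inter> dilation M V) \<and> M > Max (insert N F)"
      by (intro eventually_conj eventually_gt_at_top)
    then obtain M where M: "measure circle A * (\<kappa> / 2) \<le> measure circle (A \<inter> dilation M V)" "M > Max (insert N F)"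
      unfolding eventually_sequentially by blast
    have MN: "M > N" "\<And>q. q \<in> F \<Longrightarrow> q < M"
      using M(2) F(1) by auto
    have Mq: "M \<le> M * q" if "q \<in> G" for q
      using that G(2) by (cases q) auto
    define F' where "F' = F \<union> (*) M ` G"
    define \<psi>' where "\<psi>' q = (if q \<in> F then \<psi> q else \<phi> (q div M))" for q
    have hit: "hit_set F' \<psi>' y = hit_set F \<psi> y \<union> dilation M (hit_set G \<phi> y)" for y
    proof -
      have "hit_set F' \<psi>' y = hit_set F \<psi>' y \<union> hit_set ((*) M ` G) \<psi>' y"
        by (auto simp: F'_def hit_set_def)
      moreover have "hit_set F \<psi>' y = hit_set F \<psi> y"
        by (auto simp: hit_set_def \<psi>'_def)
      moreover have "q \<notin> F" if "q \<in> (*) M ` G" for q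
        using that Mq MN(2) by force
      then have "hit_set ((*) M ` G) \<psi>' y = hit_set ((*) M ` G) (\<lambda>q. \<phi> (q div M)) y"
        unfolding hit_set_def \<psi>'_def by (intro SUP_cong) auto
      ultimately show ?thesis
        using MN(1) by (simp add: hit_set_dilation)
    qed
    have "UNIV - hit_set F' \<psi>' z = A - A \<inter> dilation M V"
      by (auto simp: hit A_def V_def)
    then have "1 - measure circle (hit_set F' \<psi>' z) = measure circle A - measure circle (A \<inter> dilation M V)"
      using A V circle.finite_measure_compl[of "hit_set F' \<psi>' z"] circle.finite_measure_Diff[of A "A \<inter> dilation M V"]
      by simp
    also have "\<dots> \<le> measure circle A * (1 - \<kappa> / 2)"
      using M(1) by (simp add: algebra_simps)
    also have "\<dots> \<le> (1 - \<kappa> / 2) ^ t * (1 - \<kappa> / 2)"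
      using mA G(4) measure_circle_le_1[of "hit_set G \<phi> z"] by (intro mult_right_mono) auto
    finally have "1 - (1 - \<kappa> / 2) ^ Suc t \<le> measure circle (hit_set F' \<psi>' z)"
      by (simp add: mult.commute)
    moreover have "measure circle (hit_set F' \<psi>' y) \<le> real (Suc t) * \<delta>" if "y \<in> Y" for y
    proof -
      have "measure circle (hit_set F' \<psi>' y) \<le> measure circle (hit_set F \<psi> y) + measure circle (dilation M (hit_set G \<phi> y))"
        unfolding hit by (intro measure_Un_le) auto
      also have "measure circle (dilation M (hit_set G \<phi> y)) = measure circle (hit_set G \<phi> y)"
        using MN(1) by (intro measure_circle_dilation periodic_hit_set) auto
      also have "measure circle (hit_set F \<psi> y) + measure circle (hit_set G \<phi> y) \<le> real t * \<delta> + \<delta>"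
        using F(5) G(5) that by (intro add_mono) auto
      finally show ?thesis by (simp add: algebra_simps)
    qed
    moreover have "finite F'" "\<forall>q. \<psi>' q \<ge> 0"
      using F G by (auto simp: F'_def \<psi>'_def)
    moreover have "\<forall>q\<in>F'. q > N"
      using F(2) MN(1) Mq by (auto simp: F'_def intro: less_le_trans)
    ultimately show ?case by blast
  qed
  obtain F0 \<psi>0 where "\<kappa> \<le> measure circle (hit_set F0 \<psi>0 z)"
    using base[OF \<eta>] by blast
  then have "\<kappa> \<le> 1"
    using measure_circle_le_1[of "hit_set F0 \<psi>0 z"] by linarith
  then obtain t where t: "(1 - \<kappa> / 2) ^ t < \<eta>"
    using real_arch_pow_inv[OF \<eta>, of "1 - \<kappa> / 2"] \<kappa> by auto
  \<comment> \<open>Each of the t steps adds at most \<delta> for every y; \<open>Suc t\<close>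
    avoids division by zero.\<close>
  define \<delta> where "\<delta> = \<eta> / real (Suc t)"
  have \<delta>: "\<delta> > 0" "real t * \<delta> \<le> \<eta>"
    using \<eta> by (simp_all add: \<delta>_def field_simps)
  show ?thesis
    using step[OF \<delta>(1), of t] t \<delta>(2) by (smt (verit, best) order_trans)
qed

section \<open>Conclusion\<close>

lemma exists_separating_blocks:
  assumes Y: "finite Y" and z: "z \<notin> span_Q (insert 1 Y)" and \<eta>: "\<eta> > 0"
  shows "\<exists>F \<psi>. finite F \<and> (\<forall>q\<in>F. q > N) \<and> (\<forall>q. \<psi> q \<ge> 0) \<and>
    1 - \<eta> \<le> measure circle (hit_set F \<psi> z) \<and> (\<forall>y\<in>Y. measure circle (hit_set F \<psi> y) \<le> \<eta>)"
proof -
  obtain \<kappa> where "\<kappa> > 0" and base: "\<forall>\<eta>>0. \<exists>F \<psi>. finite F \<and> 0 \<notin> F \<and> (\<forall>q. \<psi> q \<ge> 0) \<and>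
    \<kappa> \<le> measure circle (hit_set F \<psi> z) \<and> (\<forall>y\<in>Y. measure circle (hit_set F \<psi> y) \<le> \<eta>)"
    using exists_hit_set_separating[OF Y z] by blast
  then show ?thesis
    by (intro boost_hit_set[of \<kappa>] \<eta>) auto
qed

section \<open>Limsup sets of blocks\<close>

lemma mem_limsup_iff: "x \<in> limsup H \<longleftrightarrow> infinite {n::nat. x \<in> H n}"
  by (auto simp: limsup_INF_SUP infinite_nat_iff_unbounded_le)

text \<open>Every tail union contains some H m of measure arbitrarily close to 1, hence has full
  measure, and the limsup is the intersection of the tails. Only infinitely many terms are large
  because each z is served by some of the blocks.\<close>

lemma emeasure_circle_limsup_eq_1:
  assumes H: "\<And>n. H n \<in> sets borel"
    and large: "infinite {n. 1 - (1 / 2) ^ n \<le> measure circle (H n)}"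
  shows "emeasure circle (limsup H) = 1"
proof -
  define B where "B n = (\<Union>m\<in>{n..}. H m)" for n
  have B: "B n \<in> sets borel" for n
    unfolding B_def using H by (intro sets.countable_UN') auto
  have "UNIV - B n \<in> null_sets circle" for n
  proof -
    have "measure circle (UNIV - B n) \<le> \<delta>" if \<delta>: "\<delta> > 0" for \<delta>
    proof -
      obtain k where k: "(1 / 2 :: real) ^ k < \<delta>"
        using real_arch_pow_inv[OF \<delta>, of "1 / 2"] by auto
      obtain m where m: "m \<ge> max n k" "1 - (1 / 2) ^ m \<le> measure circle (H m)"
        using large unfolding infinite_nat_iff_unbounded_le by blast
      have "measure circle (H m) \<le> measure circle (B n)"
        using H B m(1) by (intro circle.finite_measure_mono) (auto simp: B_def)
      moreover have "(1 / 2 :: real) ^ m \<le> (1 / 2) ^ k"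
        using m(1) by (intro power_decreasing) auto
      moreover have "measure circle (UNIV - B n) = 1 - measure circle (B n)"
        using B circle.finite_measure_compl[of "B n"] by simp
      ultimately show ?thesis
        using m(2) k by linarith
    qed
    then have "measure circle (UNIV - B n) \<le> 0"
      by (rule field_le_epsilon[of _ 0, simplified])
    then have "measure circle (UNIV - B n) = 0"
      using measure_le_0_iff by blast
    then show ?thesis
      using B by (auto simp: circle.emeasure_eq_measure)
  qed
  then have "(\<Union>n. UNIV - B n) \<in> null_sets circle"
    by (rule null_sets_UN)
  moreover have "(\<Union>n. UNIV - B n) = UNIV - limsup H"
    by (auto simp: limsup_INF_SUP B_def)
  ultimately have "measure circle (UNIV - limsup H) = 0"
    by (simp add: measure_eq_0_null_sets)
  moreover have "limsup H \<in> sets borel"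
    using H by (intro measurable_limsup) auto
  ultimately show ?thesis
    using circle.finite_measure_compl[of "limsup H"] by (simp add: circle.emeasure_eq_measure)
qed

lemma emeasure_circle_limsup_eq_0:
  assumes H: "\<And>n. H n \<in> sets borel"
    and small: "\<And>n. n \<ge> n0 \<Longrightarrow> measure circle (H n) \<le> (1 / 2) ^ n"
  shows "emeasure circle (limsup H) = 0"
proof -
  have "summable (\<lambda>n. measure circle (H n))"
  proof (rule summable_comparison_test'[where N = n0])
    show "summable (\<lambda>n. (1 / 2 :: real) ^ n)"
      by (intro summable_geometric) simp
  qed (use small in simp)
  then have "limsup H \<in> null_sets circle"
    using H by (intro borel_cantelli_limsup1) (auto simp: circle.emeasure_finite less_top[symmetric])
  then show ?thesis by auto
qed

lemma emeasure_unit_interval_Int: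
  assumes A: "A \<in> sets borel"
  shows "emeasure lebesgue ({0..1} \<inter> A) = emeasure circle A"
proof -
  have "{0..1} \<inter> A \<in> sets borel" using A by simp
  then have "emeasure lebesgue ({0..1} \<inter> A) = emeasure lborel ({0..1} \<inter> A)"
    by simp
  also have "\<dots> = emeasure lborel ({0..<1} \<inter> A)"
  proof (rule emeasure_eq_AE)
    have "AE x in lborel. x \<noteq> (1::real)"
      by (rule AE_lborel_singleton)
    then show "AE x in lborel. (x \<in> {0..1} \<inter> A) = (x \<in> {0..<1} \<inter> A)"
      by eventually_elim auto
  qed (use A in auto)
  also have "\<dots> = emeasure circle A"
    using A by (simp add: emeasure_circle)
  finally show ?thesis .
qed

text \<open>Infinitely many block sets containing x give infinitely many q since the blocks are
  disjoint; conversely each block is finite. Outside the blocks the value 0 excludes hits, the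
  inequality in \<open>W\<close> being strict.\<close>

lemma W_eq_limsup_hit_set:
  assumes fin: "\<And>n. finite (F n)" and pos: "\<And>n. 0 \<notin> F n"
    and disj: "\<And>m n q. q \<in> F m \<Longrightarrow> q \<in> F n \<Longrightarrow> m = n"
    and \<Psi>: "\<And>n q. q \<in> F n \<Longrightarrow> \<Psi> q = \<psi> n q" "\<And>q. q \<notin> (\<Union>n. F n) \<Longrightarrow> \<Psi> q = 0"
  shows "W \<Psi> y = {0..1} \<inter> limsup (\<lambda>n. hit_set (F n) (\<psi> n) y)"
proof -
  have eq: "infinite {q. q > 0 \<and> dist_int (real q * x - y) < \<Psi> q} \<longleftrightarrow> infinite {n. x \<in> hit_set (F n) (\<psi> n) y}"
    (is "infinite ?Q \<longleftrightarrow> infinite ?I") for x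
  proof
    assume "infinite ?Q"
    moreover have "?Q \<subseteq> (\<Union>n\<in>?I. F n)"
    proof
      fix q assume q: "q \<in> ?Q"
      then have "\<Psi> q \<noteq> 0"
        using dist_int_nonneg[of "real q * x - y"] by auto
      then obtain n where n: "q \<in> F n"
        using \<Psi>(2) by blast
      then have "n \<in> ?I"
        using q \<Psi>(1)[OF n] by (auto simp: hit_set_def hit_def)
      with n show "q \<in> (\<Union>n\<in>?I. F n)" by blast
    qed
    ultimately show "infinite ?I"
      using fin finite_subset by blast
  next
    assume inf: "infinite ?I"
    have "\<forall>n\<in>?I. \<exists>q. q \<in> F n \<and> dist_int (real q * x - y) < \<psi> n q"
      by (auto simp: hit_set_def hit_def)
    then obtain f where f: "\<And>n. n \<in> ?I \<Longrightarrow> f n \<in> F n \<and> dist_int (real (f n) * x - y) < \<psi> n (f n)"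
      by (metis (no_types, lifting))
    have "inj_on f ?I"
      using f disj by (metis (no_types, lifting) inj_onI)
    then have "infinite (f ` ?I)"
      using inf finite_imageD by blast
    moreover have "f ` ?I \<subseteq> ?Q"
    proof (rule image_subsetI)
      fix n assume n: "n \<in> ?I"
      then have "f n \<noteq> 0" using f pos by metis
      then show "f n \<in> ?Q"
        using f[OF n] \<Psi>(1)[of "f n" n] by simp
    qed
    ultimately show "infinite ?Q"
      using finite_subset by blast
  qed
  show ?thesis
    by (intro set_eqI) (simp only: W_def mem_Collect_eq Int_iff mem_limsup_iff eq)
qed

theorem theorem1p1:
  fixes Y Z :: "real set"
  assumes "countable Y" and "countable Z"
    and "Z \<subseteq> UNIV - span_Q ({1} \<union> Y)"
  shows "\<exists>\<psi> :: nat \<Rightarrow> real. (\<forall>q>0. \<psi> q \<ge> 0) \<and>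
    (\<forall>y\<in>Y. emeasure lebesgue (W \<psi> y) = 0) \<and>
    (\<forall>z\<in>Z. emeasure lebesgue (W \<psi> z) = 1)"
proof (cases "Z = {}")
  \<comment> \<open>With Z empty there is nothing to enumerate, and the zero function has no
    hits.\<close>
  case True
  have "\<not> dist_int t < 0" for t
    using dist_int_nonneg[of t] by linarith
  then have "W (\<lambda>_. 0) y = {}" for y
    by (simp add: W_def)
  with True show ?thesis
    by (intro exI[of _ "\<lambda>_. 0"]) simp
next
  case False
  \<comment> \<open>Each block serves one z. Dropping the second component of the decoded pair makes
    every element of Z occur infinitely often.\<close>
  define z where "z n = from_nat_into Z (fst (prod_decode n))" for n
  have z_Z: "z n \<in> Z" for n
    using False by (simp add: z_def from_nat_into)
  have z_inf: "infinite {n. z n = w}" if w: "w \<in> Z" for w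
  proof -
    obtain i where i: "from_nat_into Z i = w"
      using from_nat_into_surj[OF assms(2) w] by blast
    have "range (\<lambda>j. prod_encode (i, j)) \<subseteq> {n. z n = w}"
      by (auto simp: z_def i)
    moreover have "infinite (range (\<lambda>j. prod_encode (i, j)))"
      by (intro range_inj_infinite) (auto simp: inj_on_def)
    ultimately show ?thesis
      using finite_subset by blast
  qed
  \<comment> \<open>Finite sets exhausting Y: y belongs to \<open>Y' n\<close> from its own index
    on, so only finitely many blocks fail to control it.\<close>
  define Y' where "Y' n = {y \<in> Y. to_nat_on Y y \<le> n}" for n
  have finY': "finite (Y' n)" for n
  proof (rule inj_on_finite)
    show "inj_on (to_nat_on Y) (Y' n)"
      using inj_on_to_nat_on[OF assms(1)] by (rule inj_on_subset) (auto simp: Y'_def)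
    show "to_nat_on Y ` Y' n \<subseteq> {..n}"
      by (auto simp: Y'_def)
  qed simp
  have "z n \<notin> span_Q (insert 1 (Y' n))" for n
  proof
    assume "z n \<in> span_Q (insert 1 (Y' n))"
    moreover have "span_Q (insert 1 (Y' n)) \<subseteq> span_Q ({1} \<union> Y)"
      by (rule rat_real.span_mono) (auto simp: Y'_def)
    ultimately show False
      using assms(3) z_Z[of n] by blast
  qed
  \<comment> \<open>The error (1/2)^n is summable, as Borel-Cantelli requires for y, and tends to 0,
    as z requires.\<close>
  then have *: "\<exists>F \<psi>. finite F \<and> (\<forall>q\<in>F. q > N) \<and> (\<forall>q. \<psi> q \<ge> 0) \<and>
    1 - (1 / 2) ^ n \<le> measure circle (hit_set F \<psi> (z n)) \<and> (\<forall>y\<in>Y' n. measure circle (hit_set F \<psi> y) \<le> (1 / 2) ^ n)" for n N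
    by (rule exists_separating_blocks[OF finY']) simp
  define good where "good n N p \<longleftrightarrow> finite (fst p) \<and> (\<forall>q\<in>fst p. q > N) \<and> (\<forall>q. snd p q \<ge> 0) \<and>
    1 - (1 / 2) ^ n \<le> measure circle (hit_set (fst p) (snd p) (z n)) \<and>
    (\<forall>y\<in>Y' n. measure circle (hit_set (fst p) (snd p) y) \<le> (1 / 2) ^ n)" for n N p
  have "\<exists>p. good n N p" for n N
    using *[of N n] by (simp add: good_def)
  then obtain p where p: "\<And>n N. good n N (p n N)"
    by metis
  define F' where "F' n N = fst (p n N)" for n N
  define \<psi>' where "\<psi>' n N = snd (p n N)" for n N
  have F': "\<And>n N. finite (F' n N)" "\<And>n N q. q \<in> F' n N \<Longrightarrow> q > N" "\<And>n N q. \<psi>' n N q \<ge> 0"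
    "\<And>n N. 1 - (1 / 2) ^ n \<le> measure circle (hit_set (F' n N) (\<psi>' n N) (z n))"
    "\<And>n N y. y \<in> Y' n \<Longrightarrow> measure circle (hit_set (F' n N) (\<psi>' n N) y) \<le> (1 / 2) ^ n"
    using p unfolding good_def F'_def \<psi>'_def by blast+
  \<comment> \<open>Block n lies in (b n, b (Suc n)], so blocks are disjoint and avoid the index 0.
    Inserting N keeps the maximum defined for an empty block.\<close>
  define b where "b = rec_nat 0 (\<lambda>n N. Max (insert N (F' n N)))"
  have b_Suc: "b (Suc n) = Max (insert (b n) (F' n (b n)))" for n
    by (simp add: b_def)
  define F where "F n = F' n (b n)" for n
  define \<psi> where "\<psi> n = \<psi>' n (b n)" for n
  have F_bounds: "b n < q" "q \<le> b (Suc n)" if "q \<in> F n" for n q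
    using that F' by (auto simp: F_def b_Suc)
  have "mono b"
    using F'(1) by (intro incseq_SucI) (auto simp: b_Suc)
  have disj: "m = n" if "q \<in> F m" "q \<in> F n" for m n q
  proof (rule ccontr)
    have False if "m < n" "q \<in> F m" "q \<in> F n" for m n
      using F_bounds[of q m] F_bounds[of q n] that monoD[OF \<open>mono b\<close>, of "Suc m" n] by simp
    moreover assume "m \<noteq> n"
    ultimately show False
      using that by (meson linorder_neqE_nat)
  qed
  define \<Psi> where "\<Psi> q = (if q \<in> (\<Union>n. F n) then \<psi> (THE n. q \<in> F n) q else 0)" for q
  have \<Psi>: "\<Psi> q = \<psi> n q" if "q \<in> F n" for n q
  proof -
    have "(THE n. q \<in> F n) = n"
      using that disj by blast
    then show ?thesis
      using that by (auto simp: \<Psi>_def)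
  qed
  have W: "W \<Psi> y = {0..1} \<inter> limsup (\<lambda>n. hit_set (F n) (\<psi> n) y)" for y
  proof (rule W_eq_limsup_hit_set)
    show "0 \<notin> F n" for n
      using F_bounds(1)[of 0 n] by auto
  qed (use disj \<Psi> F' in \<open>auto simp: F_def \<Psi>_def\<close>)
  have limsup_borel: "limsup (\<lambda>n. hit_set (F n) (\<psi> n) y) \<in> sets borel" for y
    by (intro measurable_limsup) auto
  show ?thesis
  proof (intro exI[of _ \<Psi>] conjI ballI allI impI)
    show "\<Psi> q \<ge> 0" for q
      using F'(3) by (simp add: \<Psi>_def \<psi>_def)
  next
    fix y assume y: "y \<in> Y"
    have "measure circle (hit_set (F n) (\<psi> n) y) \<le> (1 / 2) ^ n" if "n \<ge> to_nat_on Y y" for n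
      using y that F'(5) by (simp add: F_def \<psi>_def Y'_def)
    then have "emeasure circle (limsup (\<lambda>n. hit_set (F n) (\<psi> n) y)) = 0"
      by (intro emeasure_circle_limsup_eq_0) auto
    then show "emeasure lebesgue (W \<Psi> y) = 0"
      unfolding W emeasure_unit_interval_Int[OF limsup_borel] .
  next
    fix w assume w: "w \<in> Z"
    have "{n. z n = w} \<subseteq> {n. 1 - (1 / 2) ^ n \<le> measure circle (hit_set (F n) (\<psi> n) w)}"
      using F'(4) by (auto simp: F_def \<psi>_def)
    then have "infinite {n. 1 - (1 / 2) ^ n \<le> measure circle (hit_set (F n) (\<psi> n) w)}"
      using z_inf[OF w] finite_subset by blast
    then have "emeasure circle (limsup (\<lambda>n. hit_set (F n) (\<psi> n) w)) = 1"
      by (intro emeasure_circle_limsup_eq_1) auto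
    then show "emeasure lebesgue (W \<Psi> w) = 1"
      unfolding W emeasure_unit_interval_Int[OF limsup_borel] .
  qed
qed

end
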